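(* Let $n\ge 3$. Let $U\subset \mathcal S^{n\times n}$ be an open set such that $O^{-1}UO=U$ for all $O\in O(n)$, and such that $U\cap\{M+tN \mid 0<t<\infty\}$ is convex for all $M\in\mathcal S^{n\times n}$ and all $N\in\mathcal S^{n\times n}_+$. Let $F\in C^1(U)$ satisfy $F(O^{-1}MO)=F(M)$ for all $M\in U$, $O\in O(n)$, and assume the matrix $\left(\frac{\partial F}{\partial M_{ij}}(M)\right)$ is positive definite for all $M\in U$. Assume that $u\in C^2(B_2\setminus\{0\})$ and $v\in C^2(B_2)$ satisfy $$u>v\qquad\text{in } B_2\setminus\{0\},$$ $$F(A^u)\ge 1,\quad A^u\in U,\quad \Delta u\le 0\qquad\text{in } B_2\setminus\{0\},$$ $$F(A^v)\le 1,\quad A^v\in U,\quad v>0\qquad\text{in } B_2 .$$ Then $$\liminf_{|x|\to 0}[u(x)-v(x)]>0 .$$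
   Context: $\mathcal S^{n\times n}$ is the set of real symmetric $n\times n$ matrices, $\mathcal S^{n\times n}_+$ the subset of positive definite ones, $O(n)$ the real orthogonal $n\times n$ matrices. $B_a\subset\mathbb R^n$ is the ball of radius $a$ centered at the origin. For a positive $C^2$ function $u$, $$A^u=-\frac{2}{n-2}u^{-\frac{n+2}{n-2}}\nabla^2u+\frac{2n}{(n-2)^2}u^{-\frac{2n}{n-2}}\nabla u\otimes\nabla u-\frac{2}{(n-2)^2}u^{-\frac{2n}{n-2}}|\nabla u|^2 I,$$ where $\nabla u$ is the gradient, $\nabla^2u$ the Hessian of $u$ and $I$ the identity matrix. *)

theory Defs
  imports "HOL-Analysis.Analysis"
begin

definition sym_matrices :: "(real^'n^'n) set" where
  "sym_matrices = {M. transpose M = M}"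

definition pos_def :: "real^'n^'n \<Rightarrow> bool" where
  "pos_def M \<longleftrightarrow> M \<in> sym_matrices \<and> (\<forall>x. x \<noteq> 0 \<longrightarrow> x \<bullet> (M *v x) > 0)"

definition gradient :: "(real^'n \<Rightarrow> real) \<Rightarrow> real^'n \<Rightarrow> real^'n" where
  "gradient f x = (THE D. GDERIV f x :> D)"

definition hessian :: "(real^'n \<Rightarrow> real) \<Rightarrow> real^'n \<Rightarrow> real^'n^'n" where
  "hessian f x = jacobian (gradient f) (at x)"

definition laplacian :: "(real^'n \<Rightarrow> real) \<Rightarrow> real^'n \<Rightarrow> real" where
  "laplacian f x = trace (hessian f x)"

(* Meant for open S. *)
definition C2_on :: "(real^'n) set \<Rightarrow> (real^'n \<Rightarrow> real) \<Rightarrow> bool" where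
  "C2_on S f \<longleftrightarrow> f differentiable_on S \<and> gradient f differentiable_on S \<and>
     continuous_on S (hessian f)"

definition conformal_hessian :: "(real^'n \<Rightarrow> real) \<Rightarrow> real^'n \<Rightarrow> real^'n^'n" where
  "conformal_hessian u x = (let n = real CARD('n); g = gradient u x in
     - (2 / (n - 2) * u x powr (- ((n + 2) / (n - 2)))) *\<^sub>R hessian u x
     + (2 * n / (n - 2)\<^sup>2 * u x powr (- (2 * n / (n - 2)))) *\<^sub>R (\<chi> i j. g $ i * g $ j)
     - (2 / (n - 2)\<^sup>2 * u x powr (- (2 * n / (n - 2))) * (norm g)\<^sup>2) *\<^sub>R mat 1)"

(* The matrix of partial derivatives of F at M, for F defined on a subset U of the symmetric
   matrices that is relatively open in them. The entries M i j and M j i are not independent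
   there; as usual, the matrix is the symmetric one that represents the differential of F with
   respect to the Frobenius inner product. Being relatively open, U determines the differential
   on symmetric directions, hence this matrix, uniquely. *)
definition matrix_gradient ::
    "(real^'n^'n) set \<Rightarrow> (real^'n^'n \<Rightarrow> real) \<Rightarrow> real^'n^'n \<Rightarrow> real^'n^'n" where
  "matrix_gradient U F M = (THE G. G \<in> sym_matrices \<and>
     (F has_derivative (\<lambda>H. \<Sum>i\<in>UNIV. \<Sum>j\<in>UNIV. G $ i $ j * H $ i $ j)) (at M within U))"

definition matrix_C1_on :: "(real^'n^'n) set \<Rightarrow> (real^'n^'n \<Rightarrow> real) \<Rightarrow> bool" where
  "matrix_C1_on U F \<longleftrightarrow> F differentiable_on U \<and> continuous_on U (matrix_gradient U F)"

end

theory Submission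
  imports Defs
begin

text \<open>Call a positive function \<open>w\<close> a supersolution if \<open>F(A\<^sup>w) \<ge> 1\<close> and a subsolution if \<open>F(A\<^sup>w) \<le> 1\<close>: since
\<open>A\<^sup>w\<close> decreases when the Hessian of \<open>w\<close> grows and \<open>F\<close> increases in the order of symmetric matrices, \<open>u\<close>
is a supersolution above the subsolution \<open>v\<close>. The two could only meet at the origin, where \<open>u\<close> may be
singular and cannot be differentiated.

A single smooth function below \<open>u\<close> with the limit value of \<open>u\<close> at the origin gives no contradiction,
but two of them with different gradients do: \<open>u\<close> is superharmonic, and a superharmonic function above
a kink stays strictly above its vertex (\<open>superharmonic_above_kink\<close>). The isolated singularity is
harmless there because \<open>u\<close> is bounded below and the logarithm serves as a barrier.

It remains to find a second function below \<open>u\<close>. Take \<open>w = v + \<epsilon> (K |x|\<^sup>2 + a \<bullet> x)\<close> with a unit vector \<open>a\<close>; it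
has the value of \<open>v\<close> at the origin, but its gradient there differs by \<open>\<epsilon> a\<close>. In the ball of radius
\<open>1 / K\<close>, for \<open>K\<close> large and then \<open>\<epsilon>\<close> small, the functions \<open>w - \<epsilon> s\<close> with \<open>0 \<le> s \<le> 2\<close> are strict
subsolutions (\<open>strict_subsolution_perturbation\<close>), and \<open>w \<le> u\<close> on the bounding sphere. If \<open>w \<le> u\<close> failed
inside, the infimum of \<open>u - w\<close> would be a negative number \<open>- \<epsilon> s\<close>, attained away from the origin, since
\<open>u - w > v - w\<close> and \<open>v - w\<close> tends to \<open>0\<close> there. At that point \<open>w - \<epsilon> s\<close> touches \<open>u\<close> from below, values and
gradients agree and the Hessians are ordered, whence \<open>A\<^sup>u \<le> A\<^bsup>w - \<epsilon> s\<^esup>\<close> and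
\<open>1 \<le> F(A\<^sup>u) \<le> F(A\<^bsup>w - \<epsilon> s\<^esup>) < 1\<close> (\<open>nondecreasing_in_matrix_order\<close>).\<close>

section \<open>Positive semidefinite matrices\<close>

definition pos_semidef :: "real^'n^'n \<Rightarrow> bool" where
  "pos_semidef M \<longleftrightarrow> M \<in> sym_matrices \<and> (\<forall>x. x \<bullet> (M *v x) \<ge> 0)"

definition outer :: "real^'n \<Rightarrow> real^'n \<Rightarrow> real^'n^'n" where
  "outer p q = (\<chi> i j. p $ i * q $ j)"

lemma outer_mult_vec: "outer p q *v x = (q \<bullet> x) *\<^sub>R p"
  by (simp add: vec_eq_iff outer_def matrix_vector_mult_def inner_vec_def sum_distrib_left
      mult_ac)

lemma norm_outer: "norm (outer p q) = norm p * norm q"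
proof -
  have row: "outer p q $ i = (p $ i) *\<^sub>R q" for i
    by (simp add: outer_def vec_eq_iff)
  show ?thesis
    by (simp add: norm_vec_def[of "outer p q"] row L2_set_left_distrib[symmetric])
      (simp add: norm_vec_def[of p] L2_set_def)
qed

lemma outer_diff_left: "outer (p - p') q = outer p q - outer p' q"
  and outer_diff_right: "outer p (q - q') = outer p q - outer p q'"
  by (simp_all add: outer_def vec_eq_iff algebra_simps)

lemma outer_in_sym: "outer p p \<in> sym_matrices"
  by (simp add: sym_matrices_def outer_def transpose_def vec_eq_iff)

lemma mat_in_sym: "mat c \<in> sym_matrices"
  by (simp add: sym_matrices_def)

lemma sym_matrices_entries: "M \<in> sym_matrices \<longleftrightarrow> (\<forall>i j. M $ i $ j = M $ j $ i)"
  by (auto simp: sym_matrices_def transpose_def vec_eq_iff)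

lemma subspace_sym: "subspace sym_matrices"
  by (simp add: subspace_def sym_matrices_entries)

lemma sym_bilinear:
  assumes "M \<in> sym_matrices"
  shows "x \<bullet> (M *v y) = y \<bullet> (M *v x)"
proof -
  have "transpose M *v x = M *v x" using assms by (simp add: sym_matrices_def)
  then have "x v* M = M *v x" by (simp add: transpose_matrix_vector)
  then show ?thesis using dot_lmul_matrix[of x M y] by (simp add: inner_commute)
qed

lemma norm_mult_vec_le: "norm (M *v x) \<le> norm M * norm (x :: real^'n)" for M :: "real^'n^'m"
proof -
  have "norm (M *v x) = L2_set (\<lambda>i. \<bar>M $ i \<bullet> x\<bar>) UNIV"
    by (simp add: norm_vec_def matrix_vector_mul_component)
  also have "\<dots> \<le> L2_set (\<lambda>i. norm (M $ i) * norm x) UNIV"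
    by (intro L2_set_mono Cauchy_Schwarz_ineq2) auto
  also have "\<dots> = norm M * norm x"
    by (simp add: L2_set_left_distrib[symmetric] norm_vec_def[of M])
  finally show ?thesis .
qed

lemma inner_outer: "G \<bullet> outer p q = p \<bullet> (G *v q)"
  by (simp add: inner_vec_def outer_def matrix_vector_mult_def sum_distrib_left mult_ac)

lemma quadratic_form_shift:
  assumes "M \<in> sym_matrices"
  shows "(x + t *\<^sub>R y) \<bullet> (M *v (x + t *\<^sub>R y))
    = x \<bullet> (M *v x) + 2 * t * (x \<bullet> (M *v y)) + t\<^sup>2 * (y \<bullet> (M *v y))"
  using sym_bilinear[OF assms, of y x]
  by (simp add: matrix_vector_right_distrib matrix_vector_mult_scaleR inner_add_left inner_add_right
      algebra_simps power2_eq_square)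

text \<open>The quadratic form stays nonnegative along the line \<open>M y + t y\<close>, where it is affine in \<open>t\<close> with
slope \<open>2 |M y|\<^sup>2\<close>.\<close>
lemma pos_semidef_null_vector:
  assumes "pos_semidef M" and "y \<bullet> (M *v y) = 0"
  shows "M *v y = 0"
proof -
  have sym: "M \<in> sym_matrices" and pos: "\<And>x. x \<bullet> (M *v x) \<ge> 0"
    using assms(1) by (auto simp: pos_semidef_def)
  define x where "x = M *v y"
  have "0 \<le> x \<bullet> (M *v x) + 2 * t * (x \<bullet> x)" for t
    using pos[of "x + t *\<^sub>R y"] quadratic_form_shift[OF sym, of x t y] assms(2)
    by (simp add: x_def)
  from this[of "- (x \<bullet> (M *v x) + 1) / (2 * (x \<bullet> x))"] have "x \<bullet> x = 0"
    by (cases "x \<bullet> x = 0") (simp_all add: field_simps)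
  then show ?thesis by (simp add: x_def)
qed

lemma mult_axis: "(M *v axis k 1) $ i = (M :: real^'n^'m) $ i $ k"
  by (simp add: matrix_vector_mult_basis column_def)

lemma axis_inner: "axis k 1 \<bullet> (x :: real^'n) = x $ k"
  by (simp add: inner_commute inner_axis)

text \<open>One step of Gaussian elimination. The value of the new form at \<open>x\<close> is the minimum of the old form
over the line through \<open>x\<close> in direction \<open>y\<close>.\<close>
lemma pos_semidef_schur_complement:
  assumes "pos_semidef M" and "y \<bullet> (M *v y) > 0"
  shows "pos_semidef (M - (1 / (y \<bullet> (M *v y))) *\<^sub>R outer (M *v y) (M *v y))"
proof -
  have sym: "M \<in> sym_matrices" and pos: "\<And>x. x \<bullet> (M *v x) \<ge> 0"
    using assms(1) by (auto simp: pos_semidef_def)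
  define c where "c = y \<bullet> (M *v y)"
  have c: "c > 0" using assms(2) c_def by simp
  show ?thesis
    unfolding pos_semidef_def c_def[symmetric]
  proof (intro conjI allI)
    show "M - (1 / c) *\<^sub>R outer (M *v y) (M *v y) \<in> sym_matrices"
      by (intro subspace_diff subspace_scale subspace_sym sym outer_in_sym)
    fix x
    define b where "b = x \<bullet> (M *v y)"
    have "0 \<le> x \<bullet> (M *v x) + 2 * (- b / c) * b + (- b / c)\<^sup>2 * c"
      using pos[of "x + (- b / c) *\<^sub>R y"] unfolding quadratic_form_shift[OF sym] b_def c_def .
    also have "\<dots> = x \<bullet> (M *v x) - b\<^sup>2 / c"
      using c by (simp add: field_simps power2_eq_square)
    finally show "0 \<le> x \<bullet> ((M - (1 / c) *\<^sub>R outer (M *v y) (M *v y)) *v x)"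
      by (simp add: matrix_vector_mult_diff_rdistrib scaleR_matrix_vector_assoc[symmetric]
          outer_mult_vec inner_diff_right b_def power2_eq_square inner_commute)
  qed
qed

text \<open>Elimination writes \<open>N\<close> as a sum of dyads \<open>y y\<^sup>T\<close>, and \<open>G \<bullet> y y\<^sup>T = y \<bullet> G y\<close>. Each step clears a row and
creates no new nonzero row, so the induction runs over the number of nonzero rows; this replaces a
spectral decomposition of \<open>N\<close>.\<close>
lemma inner_pos_def_pos_semidef:
  fixes G N :: "real^'n^'n"
  assumes G: "pos_def G" and "pos_semidef N" and "N \<noteq> 0"
  shows "G \<bullet> N > 0"
  using assms(2,3)
proof (induction "card {i. N $ i \<noteq> 0}" arbitrary: N rule: less_induct)
  case less
  have sym: "N \<in> sym_matrices" using less.prems by (simp add: pos_semidef_def)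
  obtain k where k: "N *v axis k 1 \<noteq> 0"
    using less.prems(2) mult_axis[of N] by (metis vec_eq_iff zero_index)
  define y where "y = N *v axis k 1"
  define c where "c = axis k 1 \<bullet> (N *v axis k 1)"
  have c: "c > 0"
    using pos_semidef_null_vector[OF less.prems(1)] k less.prems(1)
    unfolding c_def pos_semidef_def by (metis less_eq_real_def)
  have ck: "c = N $ k $ k" by (simp add: c_def axis_inner mult_axis)
  have y_entry: "y $ i = N $ i $ k" for i by (simp add: y_def mult_axis)
  define N' where "N' = N - (1 / c) *\<^sub>R outer y y"
  have N'_psd: "pos_semidef N'"
    using pos_semidef_schur_complement[OF less.prems(1)] c by (simp add: N'_def c_def y_def)
  have N'_entry: "N' $ i $ j = N $ i $ j - N $ i $ k * N $ j $ k / c" for i j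
    by (simp add: N'_def outer_def y_entry)
  have "N' $ i = 0" if "N $ i = 0" for i
    using that by (simp add: vec_eq_iff N'_entry)
  moreover have "N' $ k = 0"
    using c sym by (simp add: vec_eq_iff N'_entry ck sym_matrices_entries)
  moreover have "N $ k \<noteq> 0" using c ck by auto
  ultimately have "{i. N' $ i \<noteq> 0} \<subset> {i. N $ i \<noteq> 0}" by blast
  then have "card {i. N' $ i \<noteq> 0} < card {i. N $ i \<noteq> 0}"
    by (intro psubset_card_mono) auto
  then have "G \<bullet> N' \<ge> 0"
    using less.hyps[of N'] N'_psd by (cases "N' = 0") auto
  moreover have "G \<bullet> outer y y > 0"
    using G k by (simp add: inner_outer pos_def_def y_def)
  moreover have "G \<bullet> N = G \<bullet> N' + (1 / c) * (G \<bullet> outer y y)"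
    by (simp add: N'_def inner_diff_right)
  ultimately show ?case using c by (simp add: add_nonneg_pos)
qed

lemma pos_semidef_perturbed_identity:
  fixes R :: "real^'n^'n"
  assumes "R \<in> sym_matrices" and R: "norm R < c"
  shows "pos_semidef (c *\<^sub>R mat 1 + R)" and "c *\<^sub>R mat 1 + R \<noteq> 0"
proof -
  have form: "x \<bullet> ((c *\<^sub>R mat 1 + R) *v x) \<ge> (c - norm R) * (norm x)\<^sup>2" for x
  proof -
    have "\<bar>x \<bullet> (R *v x)\<bar> \<le> norm x * norm (R *v x)" by (rule Cauchy_Schwarz_ineq2)
    also have "\<dots> \<le> norm x * (norm R * norm x)" by (intro mult_left_mono norm_mult_vec_le) auto
    finally have "\<bar>x \<bullet> (R *v x)\<bar> \<le> norm R * (norm x)\<^sup>2" by (simp add: power2_eq_square mult_ac)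
    then show ?thesis
      by (simp add: matrix_vector_mult_add_rdistrib scaleR_matrix_vector_assoc[symmetric]
          inner_add_right power2_norm_eq_inner[symmetric] left_diff_distrib)
  qed
  have "x \<bullet> ((c *\<^sub>R mat 1 + R) *v x) \<ge> 0" for x
    by (rule order_trans[OF _ form]) (use R in simp)
  moreover have "c *\<^sub>R mat 1 + R \<in> sym_matrices"
    using assms by (intro subspace_add subspace_scale subspace_sym mat_in_sym)
  ultimately show "pos_semidef (c *\<^sub>R mat 1 + R)" by (simp add: pos_semidef_def)
  fix k
  have "c - norm R > 0" using R by simp
  moreover have "c - norm R \<le> axis k 1 \<bullet> ((c *\<^sub>R mat 1 + R) *v axis k 1)"
    using form[of "axis k 1"] by simp
  ultimately show "c *\<^sub>R mat 1 + R \<noteq> 0" by auto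
qed

section \<open>Monotonicity of \<open>F\<close> in the order of symmetric matrices\<close>

lemma sym_direction_stays:
  assumes U: "openin (top_of_set sym_matrices) U" and M: "M \<in> U" and H: "H \<in> sym_matrices"
  obtains e where "e > 0" and "\<And>t. \<bar>t\<bar> < e \<Longrightarrow> M + t *\<^sub>R H \<in> U"
proof -
  obtain T where T: "open T" "U = sym_matrices \<inter> T"
    using U unfolding openin_open by blast
  have "((\<lambda>t. M + t *\<^sub>R H) \<longlongrightarrow> M + 0 *\<^sub>R H) (at 0)" by (intro tendsto_intros)
  then have "\<forall>\<^sub>F t in at 0. M + t *\<^sub>R H \<in> T"
    by (rule topological_tendstoD) (use T M in auto)
  then obtain e where e: "e > 0" "\<And>t. t \<noteq> 0 \<Longrightarrow> \<bar>t\<bar> < e \<Longrightarrow> M + t *\<^sub>R H \<in> T"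
    unfolding eventually_at dist_real_def by (metis UNIV_I diff_zero)
  show thesis
  proof (rule that[OF e(1)])
    fix t :: real assume "\<bar>t\<bar> < e"
    then have "M + t *\<^sub>R H \<in> T" using e(2) M T by (cases "t = 0") auto
    moreover have "M + t *\<^sub>R H \<in> sym_matrices"
      using M T H by (intro subspace_add subspace_scale subspace_sym) auto
    ultimately show "M + t *\<^sub>R H \<in> U" using T by simp
  qed
qed

text \<open>Both matrices give the same derivative of \<open>F\<close> along the line through \<open>M\<close> in the direction
\<open>H = G1 - G2\<close>, which stays in \<open>U\<close> for a short time because \<open>H\<close> is symmetric. Hence \<open>H \<bullet> H = 0\<close>.\<close>
lemma matrix_gradient_unique:
  fixes G1 G2 :: "real^'n^'n"
  assumes U: "openin (top_of_set sym_matrices) U" and M: "M \<in> U"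
    and G1: "G1 \<in> sym_matrices" "(F has_derivative (\<bullet>) G1) (at M within U)"
    and G2: "G2 \<in> sym_matrices" "(F has_derivative (\<bullet>) G2) (at M within U)"
  shows "G1 = G2"
proof -
  define H where "H = G1 - G2"
  have "H \<in> sym_matrices" using G1 G2 by (simp add: H_def subspace_diff subspace_sym)
  then obtain e where e: "e > 0" "\<And>t. \<bar>t\<bar> < e \<Longrightarrow> M + t *\<^sub>R H \<in> U"
    using sym_direction_stays[OF U M] by metis
  have line: "((\<lambda>t. F (M + t *\<^sub>R H)) has_real_derivative G \<bullet> H) (at 0)"
    if "(F has_derivative (\<bullet>) G) (at M within U)" for G
  proof -
    have "((\<lambda>t. F (M + t *\<^sub>R H)) has_derivative (\<lambda>t. G \<bullet> (t *\<^sub>R H))) (at 0 within {-e<..<e})"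
    proof (rule has_derivative_in_compose[where f="\<lambda>t. M + t *\<^sub>R H"])
      show "((\<lambda>t. M + t *\<^sub>R H) has_derivative (\<lambda>t. t *\<^sub>R H)) (at 0 within {-e<..<e})"
        by (auto intro!: derivative_eq_intros)
      show "(F has_derivative (\<bullet>) G) (at (M + 0 *\<^sub>R H) within (\<lambda>t. M + t *\<^sub>R H) ` {-e<..<e})"
      proof (rule has_derivative_subset)
        show "(F has_derivative (\<bullet>) G) (at (M + 0 *\<^sub>R H) within U)" using that by simp
        show "(\<lambda>t. M + t *\<^sub>R H) ` {-e<..<e} \<subseteq> U" by (auto intro!: e(2))
      qed
    qed
    then have "((\<lambda>t. F (M + t *\<^sub>R H)) has_derivative (\<lambda>t. G \<bullet> (t *\<^sub>R H))) (at 0)"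
      using e(1) by (simp add: at_within_open[of 0 "{-e<..<e}"])
    then show ?thesis by (simp add: has_field_derivative_def mult_commute_abs)
  qed
  have "G1 \<bullet> H = G2 \<bullet> H"
    using DERIV_unique[OF line[OF G1(2)] line[OF G2(2)]] .
  then have "H \<bullet> H = 0" by (simp add: H_def inner_diff_left)
  then show ?thesis by (simp add: H_def)
qed

lemma sym_part_representation:
  fixes L :: "real^'n^'n \<Rightarrow> real"
  assumes L: "linear L"
  obtains G where "G \<in> sym_matrices" and "\<And>H. H \<in> sym_matrices \<Longrightarrow> L H = G \<bullet> H"
proof -
  define D where "D = adjoint L 1"
  have D: "L H = D \<bullet> H" for H
    using adjoint_works[OF L, of H 1] by (simp add: D_def inner_commute)
  define G where "G = (1/2) *\<^sub>R (D + transpose D)"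
  have tr: "transpose D \<bullet> H = D \<bullet> transpose H" for H
    by (simp add: inner_vec_def transpose_def) (rule sum.swap)
  show thesis
  proof (rule that)
    show "G \<in> sym_matrices" by (simp add: G_def sym_matrices_entries transpose_def)
    show "L H = G \<bullet> H" if "H \<in> sym_matrices" for H
      using that tr[of H] by (simp add: D G_def inner_add_left sym_matrices_def)
  qed
qed

text \<open>A derivative within \<open>U\<close> is tested only on differences of points of \<open>U\<close>, that is on symmetric
matrices, where any linear functional agrees with the inner product with a symmetric matrix.\<close>
lemma matrix_gradient_works:
  fixes U :: "(real^'n^'n) set"
  assumes U: "openin (top_of_set sym_matrices) U" and M: "M \<in> U"
    and F: "F differentiable (at M within U)"
  shows "(F has_derivative (\<bullet>) (matrix_gradient U F M)) (at M within U)"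
proof -
  obtain L where L: "(F has_derivative L) (at M within U)"
    using F by (auto simp: differentiable_def)
  then obtain G where G: "G \<in> sym_matrices" "\<And>H. H \<in> sym_matrices \<Longrightarrow> L H = G \<bullet> H"
    using sym_part_representation has_derivative_linear by metis
  have UV: "U \<subseteq> sym_matrices" using U openin_imp_subset by blast
  have FG: "(F has_derivative (\<bullet>) G) (at M within U)"
    using L G UV M unfolding has_derivative_within_alt
    by (auto simp: bounded_linear_inner_right subspace_diff subspace_sym subset_iff)
  have eq: "(\<lambda>H. \<Sum>i\<in>UNIV. \<Sum>j\<in>UNIV. G' $ i $ j * H $ i $ j) = (\<bullet>) G'" for G' :: "real^'n^'n"
    by (simp add: inner_vec_def fun_eq_iff)
  have "matrix_gradient U F M = G"
    unfolding matrix_gradient_def eq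
    using G FG matrix_gradient_unique[OF U M] by blast
  then show ?thesis using FG by simp
qed

text \<open>The derivative along the segment is \<open>G \<bullet> N\<close> with \<open>G\<close> positive definite.\<close>
lemma strictly_increasing_along_segment:
  fixes U :: "(real^'n^'n) set"
  assumes U: "openin (top_of_set sym_matrices) U"
    and F: "F differentiable_on U"
    and pd: "\<And>M. M \<in> U \<Longrightarrow> pos_def (matrix_gradient U F M)"
    and N: "pos_semidef N" "N \<noteq> 0"
    and seg: "\<And>t. 0 \<le> t \<Longrightarrow> t \<le> 1 \<Longrightarrow> M + t *\<^sub>R N \<in> U"
  shows "F M < F (M + N)"
proof -
  have der: "((\<lambda>t. F (M + t *\<^sub>R N)) has_derivative
      (\<lambda>s. matrix_gradient U F (M + t *\<^sub>R N) \<bullet> (s *\<^sub>R N))) (at t within {0..1})"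
    if t: "t \<in> {0..1}" for t
  proof (rule has_derivative_in_compose2[where t=U and g=F
        and f="\<lambda>t. M + t *\<^sub>R N" and g'="\<lambda>M. (\<bullet>) (matrix_gradient U F M)"])
    show "(F has_derivative (\<bullet>) (matrix_gradient U F y)) (at y within U)" if "y \<in> U" for y
      using matrix_gradient_works[OF U that] F that by (simp add: differentiable_on_def)
  qed (use t seg in \<open>auto intro!: derivative_eq_intros\<close>)
  obtain t where t: "t \<in> {0<..<1}" and
    mv: "F (M + 1 *\<^sub>R N) - F (M + 0 *\<^sub>R N) = matrix_gradient U F (M + t *\<^sub>R N) \<bullet> ((1 - 0) *\<^sub>R N)"
    using mvt_simple[of 0 1 "\<lambda>t. F (M + t *\<^sub>R N)",
        OF _ has_derivative_subset[OF der]] by auto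
  have "matrix_gradient U F (M + t *\<^sub>R N) \<bullet> N > 0"
    using t by (intro inner_pos_def_pos_semidef pd seg N) auto
  then show ?thesis using mv by simp
qed

text \<open>The assumption on \<open>U\<close> speaks of positive definite directions, whereas \<open>A2 - A1\<close> may be degenerate.
So \<open>A2\<close> is first moved to \<open>A2 + t I\<close>: with \<open>N = A2 - A1 + t I\<close>, both \<open>A1\<close> and \<open>A2 + t I\<close> lie on the ray
from \<open>A1 - N\<close> in the direction \<open>N\<close>, and the segment between them stays in \<open>U\<close> by convexity. Then \<open>t\<close>
tends to zero.\<close>
lemma nondecreasing_in_matrix_order:
  fixes U :: "(real^'n^'n) set"
  assumes U: "openin (top_of_set sym_matrices) U"
    and conv: "\<And>M N. M \<in> sym_matrices \<Longrightarrow> pos_def N \<Longrightarrow> convex (U \<inter> {M + t *\<^sub>R N | t. 0 < t})"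
    and F: "F differentiable_on U"
    and pd: "\<And>M. M \<in> U \<Longrightarrow> pos_def (matrix_gradient U F M)"
    and A: "A1 \<in> U" "A2 \<in> U" "pos_semidef (A2 - A1)"
  shows "F A1 \<le> F A2"
proof -
  have sym: "A1 \<in> sym_matrices" "A2 \<in> sym_matrices" using A U openin_imp_subset by blast+
  obtain e where e: "e > 0" "\<And>t. \<bar>t\<bar> < e \<Longrightarrow> A2 + t *\<^sub>R mat 1 \<in> U"
    using sym_direction_stays[OF U A(2) mat_in_sym] by metis
  have less: "F A1 < F (A2 + t *\<^sub>R mat 1)" if t: "0 < t" "t < e" for t
  proof -
    define N where "N = A2 - A1 + t *\<^sub>R mat 1"
    have N_sym: "N \<in> sym_matrices"
      unfolding N_def using sym
      by (intro subspace_add subspace_diff subspace_scale subspace_sym mat_in_sym)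
    have "x \<bullet> (N *v x) = x \<bullet> ((A2 - A1) *v x) + t * (x \<bullet> x)" for x
      by (simp add: N_def matrix_vector_mult_add_rdistrib scaleR_matrix_vector_assoc[symmetric]
          inner_add_right)
    then have N: "x \<noteq> 0 \<Longrightarrow> x \<bullet> (N *v x) > 0" for x
      using A(3) t by (simp add: pos_semidef_def add_nonneg_pos)
    then have N_pd: "pos_def N" using N_sym by (simp add: pos_def_def)
    have N_psd: "pos_semidef N"
      using N N_sym unfolding pos_semidef_def
      by (metis inner_zero_left less_eq_real_def)
    have "N \<noteq> 0" using N[of "axis undefined 1"] by auto
    define M where "M = A1 - N"
    have "M \<in> sym_matrices" using sym N_sym by (simp add: M_def subspace_diff subspace_sym)
    then have cv: "convex (U \<inter> {M + t *\<^sub>R N | t. 0 < t})" using conv N_pd by blast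
    have A2t: "A2 + t *\<^sub>R mat 1 = A1 + N" by (simp add: N_def)
    have e1: "A1 = M + 1 *\<^sub>R N" by (simp add: M_def)
    have e2: "A1 + N = M + 2 *\<^sub>R N" by (simp add: M_def scaleR_2)
    have in1: "A1 \<in> U \<inter> {M + t *\<^sub>R N | t. 0 < t}" using A(1) e1 zero_less_one by blast
    have "A1 + N \<in> U" using e(2)[of t] t A2t by simp
    then have in2: "A1 + N \<in> U \<inter> {M + t *\<^sub>R N | t. 0 < t}" using e2 zero_less_numeral by blast
    have "A1 + s *\<^sub>R N \<in> U" if s: "0 \<le> s" "s \<le> 1" for s
    proof -
      have "(1 - s) *\<^sub>R A1 + s *\<^sub>R (A1 + N) \<in> U"
        using convexD[OF cv in1 in2, of "1 - s" s] s by simp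
      then show ?thesis by (simp add: algebra_simps)
    qed
    then show ?thesis
      unfolding A2t
      using strictly_increasing_along_segment[OF U F pd N_psd \<open>N \<noteq> 0\<close>, of A1] by blast
  qed
  have "continuous_on {0..e/2} (\<lambda>t. F (A2 + t *\<^sub>R mat 1))"
    by (rule continuous_on_compose2[OF differentiable_imp_continuous_on[OF F]])
      (use e in \<open>auto intro!: continuous_intros\<close>)
  then have "((\<lambda>t. F (A2 + t *\<^sub>R mat 1)) \<longlongrightarrow> F (A2 + 0 *\<^sub>R mat 1)) (at_right 0)"
    by (rule continuous_on_Icc_at_rightD) (use e in simp)
  moreover have "\<forall>\<^sub>F t in at_right 0. F A1 \<le> F (A2 + t *\<^sub>R mat 1)"
    unfolding eventually_at_right_field using e(1) less by (intro exI[of _ e]) force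
  ultimately have "F A1 \<le> F (A2 + 0 *\<^sub>R mat 1)"
    by (intro tendsto_lowerbound[where F="at_right (0::real)"]) auto
  then show ?thesis by simp
qed

section \<open>Derivatives and interior minima\<close>

lemma C2_on_derivatives:
  fixes f :: "real^'n \<Rightarrow> real"
  assumes f: "C2_on S f" and S: "open S" and x: "x \<in> S"
  shows "(f has_derivative (\<lambda>h. gradient f x \<bullet> h)) (at x)"
    and "(gradient f has_derivative (\<lambda>h. hessian f x *v h)) (at x)"
proof -
  have "f differentiable (at x)" "gradient f differentiable (at x)"
    using f x S by (auto simp: C2_on_def differentiable_on_def at_within_open[OF x S])
  then show "(gradient f has_derivative (\<lambda>h. hessian f x *v h)) (at x)"
    by (simp add: hessian_def jacobian_works)
  obtain L where L: "(f has_derivative L) (at x)"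
    using \<open>f differentiable (at x)\<close> by (auto simp: differentiable_def)
  define D where "D = adjoint L 1"
  have "L h = h \<bullet> D" for h
    using adjoint_works[OF has_derivative_linear[OF L], of h 1] by (simp add: D_def)
  then have LD: "L = (\<lambda>h. h \<bullet> D)" by auto
  have D: "GDERIV f x :> D" using L by (simp add: gderiv_def LD)
  have "D' = D" if "GDERIV f x :> D'" for D'
  proof -
    have "(\<lambda>h. h \<bullet> D') = (\<lambda>h. h \<bullet> D)"
      using that D unfolding gderiv_def by (rule has_derivative_unique)
    then have "(D' - D) \<bullet> (D' - D) = 0"
      by (metis (no_types) inner_diff_right right_minus_eq)
    then show ?thesis by simp
  qed
  with D have "gradient f x = D" unfolding gradient_def by blast
  then show "(f has_derivative (\<lambda>h. gradient f x \<bullet> h)) (at x)"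
    using D by (simp add: gderiv_def inner_commute)
qed

text \<open>The gradient field \<open>g\<close> and its derivative are explicit, so that the test applies to combinations of
\<open>u\<close>, \<open>v\<close> and elementary functions without computing \<open>gradient\<close> and \<open>hessian\<close> of them. If the form
were negative at \<open>y\<close>, the derivative of \<open>f\<close> along \<open>x0 + t y\<close> would be negative for small \<open>t > 0\<close>.\<close>
lemma second_derivative_test:
  fixes f :: "'a::euclidean_space \<Rightarrow> real" and g :: "'a \<Rightarrow> 'a"
  assumes S: "open S" "x0 \<in> S"
    and f: "\<And>x. x \<in> S \<Longrightarrow> (f has_derivative (\<lambda>h. g x \<bullet> h)) (at x)"
    and g: "(g has_derivative H) (at x0)"
    and min: "\<And>x. x \<in> S \<Longrightarrow> f x0 \<le> f x"
  shows "g x0 = 0" and "y \<bullet> H y \<ge> 0"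
proof -
  have "(\<lambda>h. g x0 \<bullet> h) = (\<lambda>h. 0)"
    using differential_zero_maxmin[of x0 S f] f S min by blast
  from fun_cong[OF this, of "g x0"] have "g x0 \<bullet> g x0 = 0" .
  then show g0: "g x0 = 0" by simp
  show "y \<bullet> H y \<ge> 0"
  proof (rule ccontr)
    assume neg: "\<not> y \<bullet> H y \<ge> 0"
    define \<phi> where "\<phi> t = x0 + t *\<^sub>R y" for t
    define k where "k t = g (\<phi> t) \<bullet> y" for t
    have dphi: "(\<phi> has_derivative (\<lambda>t. t *\<^sub>R y)) (at t)" for t
      unfolding \<phi>_def by (auto intro!: derivative_eq_intros)
    have H: "H (t *\<^sub>R y) = t *\<^sub>R H y" for t
      using has_derivative_linear[OF g] by (simp add: linear_cmul)
    have "((\<lambda>t. g (\<phi> t)) has_derivative (\<lambda>t. H (t *\<^sub>R y))) (at 0)"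
      using diff_chain_at[OF dphi[of 0], of g H] g by (simp add: o_def \<phi>_def)
    then have "(k has_derivative (\<lambda>t. H (t *\<^sub>R y) \<bullet> y)) (at 0)"
      unfolding k_def by (rule has_derivative_inner_left)
    then have dk: "(k has_real_derivative (y \<bullet> H y)) (at 0)"
      by (simp add: has_field_derivative_def H inner_commute mult_commute_abs)
    obtain d where d: "d > 0" "\<And>t. 0 < t \<Longrightarrow> t < d \<Longrightarrow> k t < k 0"
      using DERIV_neg_dec_right[OF dk] neg by auto
    have "continuous (at 0) \<phi>" using dphi has_derivative_continuous by blast
    then have "(\<phi> \<longlongrightarrow> \<phi> 0) (at 0)" by (simp add: continuous_at)
    then have "\<forall>\<^sub>F t in at 0. \<phi> t \<in> S"
      by (rule topological_tendstoD) (use S in \<open>auto simp: \<phi>_def\<close>)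
    then obtain e where e: "e > 0" "\<And>t. t \<noteq> 0 \<Longrightarrow> \<bar>t\<bar> < e \<Longrightarrow> \<phi> t \<in> S"
      unfolding eventually_at dist_real_def by (metis UNIV_I diff_zero)
    have in_S: "\<phi> t \<in> S" if "\<bar>t\<bar> < e" for t
      using e(2)[of t] that S by (cases "t = 0") (auto simp: \<phi>_def)
    have df: "((\<lambda>t. f (\<phi> t)) has_real_derivative k t) (at t)" if "\<bar>t\<bar> < e" for t
    proof -
      have "((\<lambda>t. f (\<phi> t)) has_derivative (\<lambda>s. g (\<phi> t) \<bullet> (s *\<^sub>R y))) (at t)"
        using diff_chain_at[OF dphi[of t] f[OF in_S[OF that]]] by (simp add: o_def)
      then show ?thesis by (simp add: has_field_derivative_def k_def mult_commute_abs)
    qed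
    define t1 where "t1 = min d e / 2"
    have t1: "0 < t1" "t1 < d" "t1 < e" using d e by (auto simp: t1_def)
    have "f (\<phi> t1) < f (\<phi> 0)"
    proof (rule DERIV_neg_imp_decreasing_open[OF t1(1)])
      fix t assume t: "0 < t" "t < t1"
      then have "k t < 0" using d(2)[of t] t1 g0 by (simp add: k_def \<phi>_def)
      then show "\<exists>z. ((\<lambda>t. f (\<phi> t)) has_real_derivative z) (at t) \<and> z < 0"
        using df[of t] t t1 by force
    next
      show "continuous_on {0..t1} (\<lambda>t. f (\<phi> t))"
      proof (rule DERIV_continuous_on)
        fix t assume "t \<in> {0..t1}"
        then have "\<bar>t\<bar> < e" using t1 by auto
        then show "((\<lambda>t. f (\<phi> t)) has_real_derivative k t) (at t within {0..t1})"
          using df has_field_derivative_at_within by blast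
      qed
    qed
    moreover have "f (\<phi> 0) \<le> f (\<phi> t1)" using min[OF in_S[of t1]] t1 by (simp add: \<phi>_def)
    ultimately show False by simp
  qed
qed

text \<open>The hypotheses keep the values of \<open>m\<close> near the origin and on the sphere above the negative value
\<open>m x1\<close>, so a minimum over a compact annulus is a minimum over the punctured ball.\<close>
lemma interior_negative_minimum:
  fixes m :: "'a::euclidean_space \<Rightarrow> real"
  assumes cont: "continuous_on (cball 0 r - {0}) m"
    and bd: "\<And>x. norm x = r \<Longrightarrow> m x \<ge> 0"
    and lim: "\<And>c. c < 0 \<Longrightarrow> \<forall>\<^sub>F x in at 0. m x > c"
    and x1: "x1 \<in> ball 0 r - {0}" "m x1 < 0"
  obtains x0 where "x0 \<in> ball 0 r - {0}" and "m x0 < 0"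
    and "\<And>x. x \<in> ball 0 r - {0} \<Longrightarrow> m x0 \<le> m x"
proof -
  obtain d where d: "d > 0" "\<And>x. x \<noteq> 0 \<Longrightarrow> norm x < d \<Longrightarrow> m x > m x1"
    using lim[OF x1(2)] by (auto simp: eventually_at)
  define C where "C = cball 0 r - ball (0::'a) d"
  have "compact C" unfolding C_def by (intro compact_diff) auto
  moreover have x1C: "x1 \<in> C" using d(2)[of x1] x1 by (simp add: C_def not_less[symmetric]) blast
  moreover have CS: "C \<subseteq> cball 0 r - {0}" using d by (auto simp: C_def)
  ultimately obtain x0 where x0: "x0 \<in> C" "\<And>x. x \<in> C \<Longrightarrow> m x0 \<le> m x"
    using continuous_attains_inf[of C m] continuous_on_subset[OF cont] by blast
  have neg: "m x0 < 0" using x0(2)[OF x1C] x1(2) by simp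
  show thesis
  proof (rule that[OF _ neg])
    show "x0 \<in> ball 0 r - {0}" using x0(1) CS bd[of x0] neg d(1) by (cases "norm x0 = r") (auto simp: C_def)
    fix x :: 'a assume x: "x \<in> ball 0 r - {0}"
    show "m x0 \<le> m x"
    proof (cases "x \<in> C")
      case False
      then have "m x1 < m x" using x by (intro d(2)) (auto simp: C_def)
      then show ?thesis using x0(2)[OF x1C] by simp
    qed (rule x0(2))
  qed
qed

section \<open>Superharmonic functions near an isolated singularity\<close>

text \<open>The logarithm is the barrier: for \<open>n \<ge> 3\<close> it is strictly subharmonic, its Laplacian being
\<open>(n - 2) / |x|\<^sup>2\<close> for \<open>ln |x|\<close>, and it tends to \<open>- \<infinity>\<close> at the origin. Thus the difference of the two
sides tends to \<open>+ \<infinity>\<close> there, and a negative minimum would be attained at a point where the Laplacian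
of the difference is negative.\<close>
lemma punctured_comparison_with_barrier:
  fixes u Q :: "real^'n \<Rightarrow> real" and gu gQ :: "real^'n \<Rightarrow> real^'n"
  assumes n: "CARD('n) \<ge> 3" and \<rho>: "0 < \<rho>" "\<rho> < r" and \<delta>: "\<delta> > 0"
    and u: "\<And>x. x \<in> ball 0 r - {0} \<Longrightarrow> (u has_derivative (\<lambda>h. gu x \<bullet> h)) (at x)"
    and gu: "\<And>x. x \<in> ball 0 r - {0} \<Longrightarrow> (gu has_derivative (\<lambda>h. Hu x *v h)) (at x)"
    and trace_u: "\<And>x. x \<in> ball 0 r - {0} \<Longrightarrow> trace (Hu x) \<le> 0"
    and Q: "\<And>x. (Q has_derivative (\<lambda>h. gQ x \<bullet> h)) (at x)"
    and gQ: "\<And>x. (gQ has_derivative (\<lambda>h. HQ *v h)) (at x)"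
    and trace_Q: "trace HQ = 0"
    and bd: "\<And>x. norm x = \<rho> \<Longrightarrow> Q x \<le> u x"
    and lower: "\<And>x. x \<in> ball 0 \<rho> - {0} \<Longrightarrow> Q x - B \<le> u x"
    and x: "x \<in> ball 0 \<rho> - {0}"
  shows "u x \<ge> Q x + \<delta> * (ln (x \<bullet> x) - ln (\<rho>\<^sup>2))"
proof -
  define m where "m x = u x - Q x - \<delta> * (ln (x \<bullet> x) - ln (\<rho>\<^sup>2))" for x
  define g where "g x = gu x - gQ x - (2 * \<delta> / (x \<bullet> x)) *\<^sub>R x" for x
  define H where "H x h = Hu x *v h - HQ *v h
    - ((2 * \<delta> / (x \<bullet> x)) *\<^sub>R h - (4 * \<delta> * (x \<bullet> h) / (x \<bullet> x)\<^sup>2) *\<^sub>R x)" for x h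
  have dm: "(m has_derivative (\<lambda>h. g x \<bullet> h)) (at x)" if "x \<in> ball 0 r - {0}" for x
    unfolding m_def g_def using that
    by (auto intro!: derivative_eq_intros u Q
        simp: fun_eq_iff inner_add_right inner_diff_left inner_diff_right inner_commute field_simps)
  have dg: "(g has_derivative H x) (at x)" if "x \<in> ball 0 r - {0}" for x
    unfolding H_def g_def using that
    by (auto intro!: derivative_eq_intros gu gQ
        simp: inner_commute field_simps power2_eq_square)
  have trace_H: "(\<Sum>i\<in>UNIV. axis i 1 \<bullet> H x (axis i 1)) < 0" if x: "x \<in> ball 0 r - {0}" for x
  proof -
    have pos: "x \<bullet> x > 0" using x by simp
    have "axis i 1 \<bullet> H x (axis i 1) = Hu x $ i $ i - HQ $ i $ i
        - (2 * \<delta> / (x \<bullet> x) - 4 * \<delta> / (x \<bullet> x)\<^sup>2 * (x $ i * x $ i))" for i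
      by (simp add: H_def axis_inner mult_axis inner_axis)
    moreover have "(\<Sum>i\<in>UNIV. c * (x $ i * x $ i)) = c * (x \<bullet> x)" for c
      by (simp add: inner_vec_def sum_distrib_left)
    ultimately have "(\<Sum>i\<in>UNIV. axis i 1 \<bullet> H x (axis i 1)) =
      trace (Hu x) - trace HQ - (2 * \<delta> / (x \<bullet> x) * real CARD('n)
        - 4 * \<delta> / (x \<bullet> x)\<^sup>2 * (x \<bullet> x))"
      by (simp add: trace_def sum_subtractf del: times_divide_eq_left) simp
    also have "\<dots> = trace (Hu x) - 2 * \<delta> * (real CARD('n) - 2) / (x \<bullet> x)"
      using pos trace_Q by (simp add: field_simps power2_eq_square)
    also have "\<dots> < 0"
    proof -
      have "2 * \<delta> * (real CARD('n) - 2) / (x \<bullet> x) > 0"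
        using n \<delta> pos by (intro divide_pos_pos mult_pos_pos) auto
      then show ?thesis using trace_u[OF x] by simp
    qed
    finally show ?thesis .
  qed
  have "m x \<ge> 0"
  proof (rule ccontr)
    assume "\<not> m x \<ge> 0"
    then have neg: "m x < 0" by simp
    have sub: "ball 0 \<rho> - {0} \<subseteq> ball 0 r - {0 :: real^'n}" using \<rho> by auto
    obtain x0 where x0: "x0 \<in> ball 0 \<rho> - {0}" "m x0 < 0"
      "\<And>x. x \<in> ball 0 \<rho> - {0} \<Longrightarrow> m x0 \<le> m x"
    proof (rule interior_negative_minimum[of \<rho> m, OF _ _ _ x neg])
      show "continuous_on (cball 0 \<rho> - {0}) m"
        using \<rho> by (intro continuous_at_imp_continuous_on ballI has_derivative_continuous[OF dm]) auto
      show "m x \<ge> 0" if "norm x = \<rho>" for x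
        using bd[OF that] that by (simp add: m_def power2_norm_eq_inner[symmetric])
      show "\<forall>\<^sub>F x in at 0. m x > c" if "c < 0" for c
      proof -
        \<comment> \<open>The squared radius \<open>s\<close> makes the barrier term equal to \<open>\<bar>B\<bar> + \<bar>c\<bar> + 1\<close>, which beats
          the lower bound \<open>- B\<close> and the level \<open>c\<close>.\<close>
        define s where "s = \<rho>\<^sup>2 * exp (- ((\<bar>B\<bar> + \<bar>c\<bar> + 1) / \<delta>))"
        have s: "s > 0" "ln s = ln (\<rho>\<^sup>2) - (\<bar>B\<bar> + \<bar>c\<bar> + 1) / \<delta>"
          using \<rho> by (simp_all add: s_def ln_mult)
        have "((\<lambda>x :: real^'n. x \<bullet> x) \<longlongrightarrow> (0 :: real^'n) \<bullet> 0) (at 0)"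
          by (intro tendsto_intros)
        then have "\<forall>\<^sub>F x :: real^'n in at 0. x \<bullet> x < s"
          by (rule order_tendstoD) (use s in simp)
        moreover have "\<forall>\<^sub>F x :: real^'n in at 0. x \<in> ball 0 \<rho> - {0}"
          using \<rho> by (auto simp: eventually_at)
        ultimately show ?thesis
        proof eventually_elim
          fix x :: "real^'n" assume xs: "x \<bullet> x < s" and x: "x \<in> ball 0 \<rho> - {0}"
          have "ln (x \<bullet> x) < ln s" using xs x by (subst ln_less_cancel_iff) (auto simp: s)
          then have "\<delta> * (ln (x \<bullet> x) - ln (\<rho>\<^sup>2)) < \<delta> * (- ((\<bar>B\<bar> + \<bar>c\<bar> + 1) / \<delta>))"
            using s \<delta> by (intro mult_strict_left_mono) auto
          then show "m x > c" using lower[OF x] \<delta> by (simp add: m_def)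
        qed
      qed
    qed auto
    have "axis i 1 \<bullet> H x0 (axis i 1) \<ge> 0" for i
    proof (rule second_derivative_test(2)[where S="ball 0 \<rho> - {0}" and ?x0.0=x0 and f=m and g=g])
      show "(m has_derivative (\<lambda>h. g x \<bullet> h)) (at x)" if "x \<in> ball 0 \<rho> - {0}" for x
        using dm that sub by blast
      show "(g has_derivative H x0) (at x0)" using dg x0(1) sub by blast
      show "m x0 \<le> m x" if "x \<in> ball 0 \<rho> - {0}" for x using x0(3) that .
    qed (use x0(1) in \<open>auto simp: open_delete\<close>)
    then have "(\<Sum>i\<in>UNIV. axis i 1 \<bullet> H x0 (axis i 1)) \<ge> 0" by (intro sum_nonneg)
    then show False using trace_H[of x0] x0(1) sub by force
  qed
  then show ?thesis by (simp add: m_def)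
qed

lemma punctured_comparison:
  fixes u Q :: "real^'n \<Rightarrow> real" and gu gQ :: "real^'n \<Rightarrow> real^'n"
  assumes n: "CARD('n) \<ge> 3" and \<rho>: "0 < \<rho>" "\<rho> < r"
    and u: "\<And>x. x \<in> ball 0 r - {0} \<Longrightarrow> (u has_derivative (\<lambda>h. gu x \<bullet> h)) (at x)"
    and gu: "\<And>x. x \<in> ball 0 r - {0} \<Longrightarrow> (gu has_derivative (\<lambda>h. Hu x *v h)) (at x)"
    and trace_u: "\<And>x. x \<in> ball 0 r - {0} \<Longrightarrow> trace (Hu x) \<le> 0"
    and Q: "\<And>x. (Q has_derivative (\<lambda>h. gQ x \<bullet> h)) (at x)"
    and gQ: "\<And>x. (gQ has_derivative (\<lambda>h. HQ *v h)) (at x)"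
    and trace_Q: "trace HQ = 0"
    and bd: "\<And>x. norm x = \<rho> \<Longrightarrow> Q x \<le> u x"
    and lower: "\<And>x. x \<in> ball 0 \<rho> - {0} \<Longrightarrow> Q x - B \<le> u x"
    and x: "x \<in> ball 0 \<rho> - {0}"
  shows "u x \<ge> Q x"
proof (rule tendsto_upperbound)
  show "((\<lambda>\<delta>. Q x + \<delta> * (ln (x \<bullet> x) - ln (\<rho>\<^sup>2))) \<longlongrightarrow> Q x) (at_right 0)"
    by (auto intro!: tendsto_eq_intros)
  have "u x \<ge> Q x + \<delta> * (ln (x \<bullet> x) - ln (\<rho>\<^sup>2))" if "\<delta> > 0" for \<delta>
    using punctured_comparison_with_barrier[OF n \<rho> that u gu trace_u Q gQ trace_Q bd lower x] .
  then show "\<forall>\<^sub>F \<delta> in at_right 0. Q x + \<delta> * (ln (x \<bullet> x) - ln (\<rho>\<^sup>2)) \<le> u x"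
    by (auto simp: eventually_at_right_less intro: eventually_mono[OF eventually_at_right_less])
qed auto

text \<open>Near the origin, \<open>max w1 w2\<close> is \<open>w1 0 + b \<bullet> x + |d \<bullet> x| / 2\<close> up to \<open>o(|x|)\<close>, with \<open>b\<close> the mean and \<open>d\<close> the
difference of the gradients. On the sphere of radius \<open>\<rho>\<close> the kink \<open>|d \<bullet> x| / 2\<close> dominates
\<open>(d \<bullet> x)\<^sup>2 / (2 |d| \<rho>)\<close>, which is there the sum of the harmonic polynomial
\<open>((d \<bullet> x)\<^sup>2 - |d|\<^sup>2 |x|\<^sup>2 / n) / (2 |d| \<rho>)\<close> and the constant \<open>|d| \<rho> / (2 n)\<close>. This constant is linear in
\<open>\<rho>\<close> and survives the error \<open>o(\<rho>)\<close>, so comparison with a harmonic polynomial raises \<open>u\<close> at the origin.\<close>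
lemma superharmonic_above_kink:
  fixes u w1 w2 :: "real^'n \<Rightarrow> real" and gu :: "real^'n \<Rightarrow> real^'n"
  assumes n: "CARD('n) \<ge> 3" and r: "r > 0"
    and u: "\<And>x. x \<in> ball 0 r - {0} \<Longrightarrow> (u has_derivative (\<lambda>h. gu x \<bullet> h)) (at x)"
    and gu: "\<And>x. x \<in> ball 0 r - {0} \<Longrightarrow> (gu has_derivative (\<lambda>h. Hu x *v h)) (at x)"
    and trace_u: "\<And>x. x \<in> ball 0 r - {0} \<Longrightarrow> trace (Hu x) \<le> 0"
    and w1: "(w1 has_derivative (\<lambda>h. b1 \<bullet> h)) (at 0)"
    and w2: "(w2 has_derivative (\<lambda>h. b2 \<bullet> h)) (at 0)"
    and w12: "w1 0 = w2 0" and b12: "b1 \<noteq> b2"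
    and uw1: "\<And>x. x \<in> ball 0 r - {0} \<Longrightarrow> w1 x \<le> u x"
    and uw2: "\<And>x. x \<in> ball 0 r - {0} \<Longrightarrow> w2 x \<le> u x"
  obtains c where "c > w1 0" and "\<forall>\<^sub>F x in at 0. u x \<ge> c"
proof -
  define N where "N = real CARD('n)"
  have N: "N \<ge> 3" using n by (simp add: N_def)
  define d where "d = b2 - b1"
  have d: "norm d > 0" using b12 by (simp add: d_def)
  define b where "b = (1/2) *\<^sub>R (b1 + b2)"
  \<comment> \<open>This slope makes the first-order error on the sphere half of the gain \<open>norm d * \<rho> / (2 * N)\<close>;
    the other half is the constant \<open>c\<close> below.\<close>
  define \<eta> where "\<eta> = norm d / (4 * N)"
  have \<eta>: "\<eta> > 0" using d N by (simp add: \<eta>_def)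
  have near: "\<exists>s>0. \<forall>x. norm x < s \<longrightarrow> w1 0 + \<beta> \<bullet> x - \<eta> * norm x \<le> w x"
    if dw: "(w has_derivative (\<lambda>h. \<beta> \<bullet> h)) (at 0)" and w0: "w 0 = w1 0"
    for w :: "real^'n \<Rightarrow> real" and \<beta>
  proof -
    obtain s where s: "s > 0" "\<And>x. norm x < s \<Longrightarrow> \<bar>w x - w 0 - \<beta> \<bullet> x\<bar> \<le> \<eta> * norm x"
      using dw \<eta> unfolding has_derivative_at_alt by (metis diff_zero real_norm_def)
    have "w1 0 + \<beta> \<bullet> x - \<eta> * norm x \<le> w x" if "norm x < s" for x
      using s(2)[OF that] w0 by linarith
    then show ?thesis using s(1) by blast
  qed
  obtain s1 where s1: "s1 > 0" "\<And>x. norm x < s1 \<Longrightarrow> w1 0 + b1 \<bullet> x - \<eta> * norm x \<le> w1 x"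
    using near[OF w1] by blast
  obtain s2 where s2: "s2 > 0" "\<And>x. norm x < s2 \<Longrightarrow> w1 0 + b2 \<bullet> x - \<eta> * norm x \<le> w2 x"
    using near[OF w2] w12 by auto
  define \<rho> where "\<rho> = min r (min s1 s2) / 2"
  have \<rho>: "0 < \<rho>" "\<rho> < r" "\<rho> < s1" "\<rho> < s2" using r s1(1) s2(1) by (auto simp: \<rho>_def)
  have below: "w1 0 + b \<bullet> x + \<bar>d \<bullet> x\<bar> / 2 - \<eta> * norm x \<le> u x" if "x \<noteq> 0" "norm x \<le> \<rho>" for x
  proof -
    have "x \<in> ball 0 r - {0}" using that \<rho> by auto
    then have "w1 0 + b1 \<bullet> x - \<eta> * norm x \<le> u x" "w1 0 + b2 \<bullet> x - \<eta> * norm x \<le> u x"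
      using s1(2)[of x] s2(2)[of x] uw1[of x] uw2[of x] that \<rho> by auto
    then show ?thesis by (auto simp: b_def d_def inner_add_left inner_diff_left abs_if field_simps)
  qed
  define \<kappa> where "\<kappa> = 1 / (norm d * \<rho>)"
  have \<kappa>: "\<kappa> > 0" using d \<rho> by (simp add: \<kappa>_def)
  define c where "c = norm d * \<rho> / (4 * N)"
  have c: "c > 0" using d \<rho> N by (simp add: c_def)
  have c_eq: "c = \<eta> * \<rho>" by (simp add: c_def \<eta>_def)
  define Q where "Q x = w1 0 + b \<bullet> x + (\<kappa> / 2) * ((d \<bullet> x)\<^sup>2 - (norm d)\<^sup>2 / N * (x \<bullet> x)) + c" for x
  define gQ where "gQ x = b + \<kappa> *\<^sub>R ((d \<bullet> x) *\<^sub>R d - ((norm d)\<^sup>2 / N) *\<^sub>R x)" for x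
  define HQ where "HQ = \<kappa> *\<^sub>R (outer d d - ((norm d)\<^sup>2 / N) *\<^sub>R mat 1)"
  have HQ_mult: "HQ *v h = \<kappa> *\<^sub>R ((d \<bullet> h) *\<^sub>R d - ((norm d)\<^sup>2 / N) *\<^sub>R h)" for h
    by (simp add: HQ_def matrix_vector_mult_diff_rdistrib scaleR_matrix_vector_assoc[symmetric]
        outer_mult_vec)
  have dQ: "(Q has_derivative (\<lambda>h. gQ x \<bullet> h)) (at x)" for x
    unfolding Q_def gQ_def using N
    by (auto intro!: derivative_eq_intros
        simp: inner_add_left inner_diff_left inner_commute power2_eq_square algebra_simps)
  have dgQ: "(gQ has_derivative (\<lambda>h. HQ *v h)) (at x)" for x
    unfolding gQ_def HQ_mult by (auto intro!: derivative_eq_intros simp: inner_commute)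
  have trace_Q: "trace HQ = 0"
  proof -
    have "trace HQ = \<kappa> * ((\<Sum>i\<in>UNIV. d $ i * d $ i) - (norm d)\<^sup>2 / N * N)"
      by (simp add: HQ_def trace_def outer_def mat_def N_def sum_subtractf sum_distrib_left[symmetric])
    also have "\<dots> = 0"
      using N by (simp add: power2_norm_eq_inner inner_vec_def)
    finally show ?thesis .
  qed
  have abs_le: "\<bar>d \<bullet> x\<bar> \<le> norm d * norm x" for x by (rule Cauchy_Schwarz_ineq2)
  have "\<kappa> * (d \<bullet> x)\<^sup>2 \<le> \<bar>d \<bullet> x\<bar>" if "norm x \<le> \<rho>" for x
  proof -
    have "\<bar>d \<bullet> x\<bar> \<le> norm d * \<rho>" using abs_le[of x] mult_left_mono[OF that, of "norm d"] by simp
    then have "\<bar>d \<bullet> x\<bar> * \<bar>d \<bullet> x\<bar> \<le> (norm d * \<rho>) * \<bar>d \<bullet> x\<bar>" by (intro mult_right_mono) auto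
    then show ?thesis using d \<rho> by (simp add: \<kappa>_def field_simps power2_eq_square)
  qed note quad_le = this
  have bd: "Q x \<le> u x" if x: "norm x = \<rho>" for x
  proof -
    have "\<kappa> / 2 * ((norm d)\<^sup>2 / N * (x \<bullet> x)) = 2 * c"
      using d \<rho> N x by (simp add: \<kappa>_def c_def power2_norm_eq_inner[symmetric] field_simps
          power2_eq_square)
    then have "Q x = w1 0 + b \<bullet> x + \<kappa> * (d \<bullet> x)\<^sup>2 / 2 - c"
      unfolding Q_def right_diff_distrib by simp
    also have "\<dots> \<le> w1 0 + b \<bullet> x + \<bar>d \<bullet> x\<bar> / 2 - \<eta> * norm x"
      using quad_le[of x] x by (simp add: c_eq)
    also have "\<dots> \<le> u x" using below[of x] x \<rho> by auto
    finally show ?thesis .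
  qed
  have lower: "Q x - 2 * c \<le> u x" if x: "x \<in> ball 0 \<rho> - {0}" for x
  proof -
    have "0 \<le> \<kappa> / 2 * ((norm d)\<^sup>2 / N * (x \<bullet> x))" using \<kappa> N by simp
    then have "Q x \<le> w1 0 + b \<bullet> x + \<kappa> * (d \<bullet> x)\<^sup>2 / 2 + c"
      unfolding Q_def right_diff_distrib by simp
    moreover have "\<eta> * norm x \<le> c" using x \<eta> by (auto simp: c_eq)
    ultimately show ?thesis using below[of x] quad_le[of x] x by auto
  qed
  have uQ: "u x \<ge> Q x" if "x \<in> ball 0 \<rho> - {0}" for x
    using punctured_comparison[OF n \<rho>(1,2) u gu trace_u dQ dgQ trace_Q bd lower that] .
  have "continuous (at 0) Q" using dQ has_derivative_continuous by blast
  then have "(Q \<longlongrightarrow> Q 0) (at 0)" by (simp add: continuous_at)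
  then have "\<forall>\<^sub>F x in at 0. Q x > w1 0 + c / 2"
    by (rule order_tendstoD) (use c in \<open>simp add: Q_def\<close>)
  moreover have "\<forall>\<^sub>F x :: real^'n in at 0. x \<in> ball 0 \<rho> - {0}"
    using \<rho> by (auto simp: eventually_at)
  ultimately have "\<forall>\<^sub>F x in at 0. u x \<ge> w1 0 + c / 2"
    by eventually_elim (use uQ in force)
  then show thesis using c by (intro that[of "w1 0 + c / 2"]) auto
qed

section \<open>The conformal Hessian as a function of the 2-jet\<close>

text \<open>The matrix \<open>A\<^sup>w\<close> as a function of the value \<open>z\<close>, the gradient \<open>p\<close> and the Hessian \<open>H\<close> of \<open>w\<close> at a point.\<close>
definition conformal_jet :: "real \<Rightarrow> real^'n \<Rightarrow> real^'n^'n \<Rightarrow> real^'n^'n" where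
  "conformal_jet z p H = (let n = real CARD('n) in
     - (2 / (n - 2) * z powr (- ((n + 2) / (n - 2)))) *\<^sub>R H
     + z powr (- (2 * n / (n - 2))) *\<^sub>R
         ((2 * n / (n - 2)\<^sup>2) *\<^sub>R outer p p - (2 / (n - 2)\<^sup>2 * (norm p)\<^sup>2) *\<^sub>R mat 1))"

lemma conformal_hessian_eq: "conformal_hessian u x = conformal_jet (u x) (gradient u x) (hessian u x)"
  unfolding conformal_hessian_def conformal_jet_def outer_def Let_def scaleR_diff_right scaleR_scaleR
  by (simp add: mult_ac)

text \<open>The factor of \<open>- H\<close> in \<open>conformal_jet z p H\<close>. The type argument supplies the dimension.\<close>
definition hess_coeff :: "'n itself \<Rightarrow> real \<Rightarrow> real" where
  "hess_coeff _ z = 2 / (real CARD('n) - 2) * z powr (- ((real CARD('n) + 2) / (real CARD('n) - 2)))"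

lemma conformal_jet_add_hess:
  "conformal_jet z p (H + H') = conformal_jet z p H - hess_coeff TYPE('n) z *\<^sub>R (H' :: real^'n^'n)"
  by (simp add: conformal_jet_def hess_coeff_def Let_def scaleR_right_distrib)

lemma hess_coeff_pos:
  assumes "CARD('n) \<ge> 3" and "z > 0"
  shows "hess_coeff TYPE('n) z > 0"
  using assms by (auto simp: hess_coeff_def intro!: mult_pos_pos divide_pos_pos)

lemma hess_coeff_antimono:
  assumes "CARD('n) \<ge> 3" and "0 < z" and "z \<le> z'"
  shows "hess_coeff TYPE('n) z' \<le> hess_coeff TYPE('n) z"
  using assms unfolding hess_coeff_def by (intro mult_left_mono powr_mono2') auto

lemma conformal_jet_sym_iff:
  fixes H :: "real^'n^'n"
  assumes n: "CARD('n) \<ge> 3" and z: "z > 0"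
  shows "conformal_jet z p H \<in> sym_matrices \<longleftrightarrow> H \<in> sym_matrices"
proof -
  have eq: "conformal_jet z p H = conformal_jet z p 0 - hess_coeff TYPE('n) z *\<^sub>R H"
    using conformal_jet_add_hess[of z p 0 H] by simp
  have "conformal_jet z p 0 \<in> sym_matrices"
    unfolding conformal_jet_def Let_def scaleR_zero_right add_0
    by (intro subspace_diff subspace_scale subspace_sym outer_in_sym mat_in_sym)
  then show ?thesis
    using hess_coeff_pos[OF n z] by (auto simp: eq sym_matrices_entries)
qed

lemma powr_neg_lipschitz:
  fixes q m :: real
  assumes "q \<ge> 0" and m: "m > 0"
  obtains L where "L \<ge> 0" and "\<And>z z'. m \<le> z \<Longrightarrow> m \<le> z' \<Longrightarrow> \<bar>z powr (- q) - z' powr (- q)\<bar> \<le> L * \<bar>z - z'\<bar>"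
proof (rule that)
  show "0 \<le> q * m powr (- q - 1)" using assms by simp
  fix z z' assume zz: "m \<le> z" "m \<le> z'"
  have "norm (z powr (- q) - z' powr (- q)) \<le> q * m powr (- q - 1) * norm (z - z')"
  proof (rule field_differentiable_bound[of "{m..}"])
    fix y assume y: "y \<in> {m..}"
    show "((\<lambda>z. z powr (- q)) has_real_derivative - q * y powr (- q - 1)) (at y within {m..})"
      using y m by (intro has_field_derivative_at_within[OF has_real_derivative_powr]) auto
    have "y powr (- q - 1) \<le> m powr (- q - 1)" using y assms by (intro powr_mono2') auto
    then show "norm (- q * y powr (- q - 1)) \<le> q * m powr (- q - 1)"
      using assms by (simp add: abs_mult mult_left_mono)
  qed (use zz in auto)
  then show "\<bar>z powr (- q) - z' powr (- q)\<bar> \<le> q * m powr (- q - 1) * \<bar>z - z'\<bar>" by simp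
qed

text \<open>The bound on how much a small change of value and gradient can move \<open>A\<^sup>w\<close>: the powers of \<open>z\<close> are
Lipschitz away from \<open>0\<close>, and \<open>p\<close> enters through the dyad \<open>p p\<^sup>T\<close> and \<open>|p|\<^sup>2\<close>.\<close>
lemma conformal_jet_lipschitz:
  fixes m P :: real
  assumes n: "CARD('n) \<ge> 3" and m: "m > 0" and P: "P \<ge> 0"
  obtains L where "L \<ge> 0" and
    "\<And>z z' (p :: real^'n) p' H. m \<le> z \<Longrightarrow> m \<le> z' \<Longrightarrow> norm p \<le> P \<Longrightarrow> norm p' \<le> P \<Longrightarrow> norm H \<le> P \<Longrightarrow>
       norm (conformal_jet z p H - conformal_jet z' p' H) \<le> L * (\<bar>z - z'\<bar> + norm (p - p'))"
proof -
  define \<alpha> where "\<alpha> = 2 / (real CARD('n) - 2)"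
  define \<beta> where "\<beta> = 2 * real CARD('n) / (real CARD('n) - 2)\<^sup>2"
  define \<gamma> where "\<gamma> = 2 / (real CARD('n) - 2)\<^sup>2"
  define q1 where "q1 = (real CARD('n) + 2) / (real CARD('n) - 2)"
  define q2 where "q2 = 2 * real CARD('n) / (real CARD('n) - 2)"
  have pos: "\<alpha> \<ge> 0" "\<beta> \<ge> 0" "\<gamma> \<ge> 0" "q1 \<ge> 0" "q2 \<ge> 0"
    using n by (auto simp: \<alpha>_def \<beta>_def \<gamma>_def q1_def q2_def)
  define B where "B p = \<beta> *\<^sub>R outer p p - (\<gamma> * (norm p)\<^sup>2) *\<^sub>R (mat 1 :: real^'n^'n)" for p
  define c0 where "c0 = norm (mat 1 :: real^'n^'n)"
  have c0: "c0 \<ge> 0" by (simp add: c0_def)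
  have A: "conformal_jet z p H = z powr (- q2) *\<^sub>R B p - (\<alpha> * z powr (- q1)) *\<^sub>R H"
    for z and p :: "real^'n" and H
    by (simp add: conformal_jet_def B_def \<alpha>_def \<beta>_def \<gamma>_def q1_def q2_def Let_def)
  obtain L1 where L1: "L1 \<ge> 0" "\<And>z z'. m \<le> z \<Longrightarrow> m \<le> z' \<Longrightarrow> \<bar>z powr (- q1) - z' powr (- q1)\<bar> \<le> L1 * \<bar>z - z'\<bar>"
    using powr_neg_lipschitz[OF pos(4) m] by blast
  obtain L2 where L2: "L2 \<ge> 0" "\<And>z z'. m \<le> z \<Longrightarrow> m \<le> z' \<Longrightarrow> \<bar>z powr (- q2) - z' powr (- q2)\<bar> \<le> L2 * \<bar>z - z'\<bar>"
    using powr_neg_lipschitz[OF pos(5) m] by blast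
  define b where "b = \<beta> + \<gamma> * c0"
  have b: "b \<ge> 0" using pos c0 by (simp add: b_def)
  have B_bound: "norm (B p) \<le> b * P\<^sup>2" if "norm p \<le> P" for p
  proof -
    have "norm (B p) \<le> \<beta> * (norm p)\<^sup>2 + \<gamma> * (norm p)\<^sup>2 * c0"
      unfolding B_def by (rule order_trans[OF norm_triangle_ineq4])
        (use pos in \<open>simp add: norm_outer power2_eq_square c0_def\<close>)
    also have "\<dots> = b * (norm p)\<^sup>2" by (simp add: b_def algebra_simps)
    also have "\<dots> \<le> b * P\<^sup>2" using that b by (intro mult_left_mono power_mono) auto
    finally show ?thesis .
  qed
  have B_lip: "norm (B p - B p') \<le> 2 * b * P * norm (p - p')"
    if p: "norm p \<le> P" "norm p' \<le> P" for p p'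
  proof -
    have "norm (outer p p - outer p' p') = norm (outer (p - p') p + outer p' (p - p'))"
      by (simp add: outer_diff_left outer_diff_right)
    also have "\<dots> \<le> norm (p - p') * norm p + norm p' * norm (p - p')"
      by (rule order_trans[OF norm_triangle_ineq]) (simp add: norm_outer)
    also have "\<dots> \<le> norm (p - p') * P + P * norm (p - p')"
      using p by (intro add_mono mult_left_mono mult_right_mono) auto
    finally have o: "norm (outer p p - outer p' p') \<le> 2 * P * norm (p - p')" by simp
    have "\<bar>(norm p)\<^sup>2 - (norm p')\<^sup>2\<bar> = \<bar>norm p - norm p'\<bar> * (norm p + norm p')"
      by (simp add: power2_eq_square square_diff_square_factored abs_mult)
    also have "\<dots> \<le> norm (p - p') * (2 * P)"
      using p by (intro mult_mono norm_triangle_ineq3) auto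
    finally have s: "\<bar>(norm p)\<^sup>2 - (norm p')\<^sup>2\<bar> \<le> 2 * P * norm (p - p')" by (simp add: mult_ac)
    have "B p - B p' = \<beta> *\<^sub>R (outer p p - outer p' p') - (\<gamma> * ((norm p)\<^sup>2 - (norm p')\<^sup>2)) *\<^sub>R mat 1"
      by (simp add: B_def algebra_simps)
    then have "norm (B p - B p') \<le> \<beta> * norm (outer p p - outer p' p')
        + \<gamma> * \<bar>(norm p)\<^sup>2 - (norm p')\<^sup>2\<bar> * c0"
      by (simp only:) (rule order_trans[OF norm_triangle_ineq4],
          use pos in \<open>simp add: abs_mult c0_def\<close>)
    also have "\<dots> \<le> \<beta> * (2 * P * norm (p - p')) + \<gamma> * (2 * P * norm (p - p')) * c0"
      using pos c0 o s by (intro add_mono mult_left_mono mult_right_mono) auto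
    also have "\<dots> = 2 * b * P * norm (p - p')" by (simp add: b_def algebra_simps)
    finally show ?thesis .
  qed
  define e where "e = m powr (- q2)"
  have e: "e \<ge> 0" by (simp add: e_def)
  define L where "L = \<alpha> * L1 * P + L2 * (b * P\<^sup>2) + e * (2 * b * P)"
  show thesis
  proof (rule that)
    show "L \<ge> 0" using pos L1(1) L2(1) P b e by (simp add: L_def)
    fix z z' and p p' :: "real^'n" and H :: "real^'n^'n"
    assume z: "m \<le> z" "m \<le> z'" and p: "norm p \<le> P" "norm p' \<le> P" and H: "norm H \<le> P"
    have ez: "z' powr (- q2) \<le> e" unfolding e_def using z m pos by (intro powr_mono2') auto
    have "conformal_jet z p H - conformal_jet z' p' H =
      (z powr (- q2) - z' powr (- q2)) *\<^sub>R B p + z' powr (- q2) *\<^sub>R (B p - B p')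
        - (\<alpha> * (z powr (- q1) - z' powr (- q1))) *\<^sub>R H"
      by (simp add: A algebra_simps)
    also have "norm \<dots> \<le> \<bar>z powr (- q2) - z' powr (- q2)\<bar> * norm (B p)
        + z' powr (- q2) * norm (B p - B p') + \<alpha> * \<bar>z powr (- q1) - z' powr (- q1)\<bar> * norm H"
      by (rule order_trans[OF norm_triangle_ineq4], rule add_mono,
          rule order_trans[OF norm_triangle_ineq]) (use pos in \<open>simp_all add: abs_mult\<close>)
    also have "\<dots> \<le> (L2 * \<bar>z - z'\<bar>) * (b * P\<^sup>2) + e * (2 * b * P * norm (p - p'))
        + \<alpha> * (L1 * \<bar>z - z'\<bar>) * P"
      using pos L1(1) L2(1) e
      by (intro add_mono mult_mono mult_left_mono L1 L2 z p H ez B_bound B_lip) auto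
    also have "\<dots> = (\<alpha> * L1 * P + L2 * (b * P\<^sup>2)) * \<bar>z - z'\<bar> + e * (2 * b * P) * norm (p - p')"
      by (simp add: algebra_simps)
    also have "\<dots> \<le> L * \<bar>z - z'\<bar> + L * norm (p - p')"
      using pos L1(1) L2(1) P b e by (intro add_mono[OF mult_right_mono mult_right_mono]) (auto simp: L_def)
    finally show "norm (conformal_jet z p H - conformal_jet z' p' H) \<le> L * (\<bar>z - z'\<bar> + norm (p - p'))"
      by (simp add: algebra_simps)
  qed
qed

section \<open>Tilted strict subsolutions\<close>

lemma compact_sym_neighbourhood:
  assumes U: "openin (top_of_set sym_matrices) U" and K: "compact K" "K \<subseteq> U"
  obtains d where "d > 0"
    and "\<And>A N. A \<in> K \<Longrightarrow> N \<in> sym_matrices \<Longrightarrow> norm N \<le> d \<Longrightarrow> A + N \<in> U"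
proof -
  obtain T where T: "open T" "U = sym_matrices \<inter> T"
    using U unfolding openin_open by blast
  obtain d where d: "d > 0" "(\<Union>A\<in>K. cball A d) \<subseteq> T"
    using compact_subset_open_imp_cball_epsilon_subset[OF K(1) T(1)] K(2) T(2) by blast
  show thesis
  proof (rule that[OF d(1)])
    fix A N :: "real^'a^'a" assume A: "A \<in> K" and N: "N \<in> sym_matrices" "norm N \<le> d"
    have "A + N \<in> cball A d" using N by (simp add: dist_norm)
    then have "A + N \<in> T" using d(2) A by blast
    moreover have "A + N \<in> sym_matrices"
      using A K T N by (intro subspace_add subspace_sym) auto
    ultimately show "A + N \<in> U" using T(2) by simp
  qed
qed

lemma continuous_on_conformal_jet:
  fixes p :: "'a::topological_space \<Rightarrow> real^'n"
  assumes "continuous_on S z" "continuous_on S p" "continuous_on S H" and "\<And>x. x \<in> S \<Longrightarrow> z x > 0"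
  shows "continuous_on S (\<lambda>x. conformal_jet (z x) (p x) (H x))"
proof -
  have outer_cont: "continuous_on S (\<lambda>x. outer (p x) (p x))"
    unfolding outer_def by (intro continuous_on_vec_lambda continuous_intros assms)
  have powr_cont: "continuous_on S (\<lambda>x. z x powr q)" for q
    using assms(4) by (intro continuous_on_powr continuous_on_const assms) force
  show ?thesis
    unfolding conformal_jet_def Let_def
    by (intro continuous_on_add continuous_on_diff continuous_on_scaleR continuous_on_mult
        continuous_on_const continuous_on_minus continuous_on_power continuous_on_norm
        outer_cont powr_cont assms)
qed

text \<open>Adding \<open>\<epsilon> (K |x|\<^sup>2 + a \<bullet> x - s)\<close> to \<open>v\<close> changes the Hessian by \<open>2 \<epsilon> K I\<close>, which lowers \<open>A\<^sup>v\<close> by a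
multiple of \<open>\<epsilon> K I\<close>. On the ball of radius \<open>1 / K\<close> the changes of value and gradient are at most
\<open>4 \<epsilon>\<close> and \<open>3 \<epsilon>\<close>, uniformly in \<open>K\<close>, and move \<open>A\<^sup>v\<close> by at most \<open>7 L \<epsilon>\<close>. For large \<open>K\<close> the first effect
wins and \<open>F\<close> drops strictly below its value at \<open>A\<^sup>v\<close>; for small \<open>\<epsilon>\<close> the segment between the two
matrices stays in \<open>U\<close>. Since \<open>K\<close> and \<open>\<epsilon>0\<close> do not depend on \<open>s\<close>, the perturbed function can be slid
vertically.\<close>
lemma strict_subsolution_perturbation:
  fixes U :: "(real^'n^'n) set" and v :: "real^'n \<Rightarrow> real"
  assumes n: "CARD('n) \<ge> 3"
    and U: "openin (top_of_set sym_matrices) U"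
    and F: "F differentiable_on U"
    and pd: "\<And>M. M \<in> U \<Longrightarrow> pos_def (matrix_gradient U F M)"
    and v: "C2_on (ball 0 2) v"
    and sub: "\<And>x. x \<in> ball 0 2 \<Longrightarrow>
       F (conformal_hessian v x) \<le> 1 \<and> conformal_hessian v x \<in> U \<and> v x > 0"
    and a: "norm a = 1"
  obtains K \<epsilon>0 where "K \<ge> 1" and "\<epsilon>0 > 0"
    and "\<And>\<epsilon> s x. 0 < \<epsilon> \<Longrightarrow> \<epsilon> \<le> \<epsilon>0 \<Longrightarrow> 0 \<le> s \<Longrightarrow> s \<le> 2 \<Longrightarrow> norm x \<le> 1 / K \<Longrightarrow>
      conformal_jet (v x + \<epsilon> * (K * (x \<bullet> x) + a \<bullet> x - s)) (gradient v x + \<epsilon> *\<^sub>R ((2 * K) *\<^sub>R x + a))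
        (hessian v x + (2 * \<epsilon> * K) *\<^sub>R mat 1) \<in> {A \<in> U. F A < 1}"
proof -
  let ?B = "cball (0 :: real^'n) 1"
  have sub_ball: "x \<in> ball 0 2" if "x \<in> ?B" for x using that by auto
  have BS: "?B \<subseteq> ball 0 2" using sub_ball by blast
  have cont: "continuous_on ?B v" "continuous_on ?B (gradient v)" "continuous_on ?B (hessian v)"
    using v BS unfolding C2_on_def
    by (meson differentiable_imp_continuous_on continuous_on_subset)+
  have comp: "compact ?B" "?B \<noteq> {}" by auto
  obtain xm where xm: "xm \<in> ?B" "\<And>x. x \<in> ?B \<Longrightarrow> v xm \<le> v x"
    using continuous_attains_inf[OF comp cont(1)] by blast
  obtain xM where xM: "xM \<in> ?B" "\<And>x. x \<in> ?B \<Longrightarrow> v x \<le> v xM"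
    using continuous_attains_sup[OF comp cont(1)] by blast
  have "bounded (gradient v ` ?B)" "bounded (hessian v ` ?B)"
    by (intro compact_imp_bounded compact_continuous_image cont comp)+
  then obtain P1 P2 where P12: "\<forall>x\<in>?B. norm (gradient v x) \<le> P1" "\<forall>x\<in>?B. norm (hessian v x) \<le> P2"
    unfolding bounded_iff by blast
  define m where "m = v xm / 2"
  have m: "m > 0" using sub[OF sub_ball[OF xm(1)]] by (simp add: m_def)
  define P where "P = max (P1 + 1) (max P2 0)"
  have P: "P \<ge> 0" "\<And>x. x \<in> ?B \<Longrightarrow> norm (gradient v x) + 1 \<le> P" "\<And>x. x \<in> ?B \<Longrightarrow> norm (hessian v x) \<le> P"
    using P12 unfolding P_def by (force simp: le_max_iff_disj)+
  obtain L where L: "L \<ge> 0" and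
    lip: "\<And>z z' (p :: real^'n) p' H. m \<le> z \<Longrightarrow> m \<le> z' \<Longrightarrow> norm p \<le> P \<Longrightarrow> norm p' \<le> P \<Longrightarrow> norm H \<le> P \<Longrightarrow>
       norm (conformal_jet z p H - conformal_jet z' p' H) \<le> L * (\<bar>z - z'\<bar> + norm (p - p'))"
    using conformal_jet_lipschitz[OF n m P(1)] by metis
  define lo where "lo = hess_coeff TYPE('n) (v xM + m)"
  define hi where "hi = hess_coeff TYPE('n) m"
  have lo: "lo > 0" unfolding lo_def using m xM(2)[OF xm(1)] by (intro hess_coeff_pos[OF n]) (simp add: m_def)
  have hi: "hi > 0" unfolding hi_def by (intro hess_coeff_pos[OF n] m)
  \<comment> \<open>Chosen such that \<open>2 * lo * K\<close>, the gain from the Hessian, exceeds the loss \<open>7 * L\<close>.\<close>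
  define K where "K = 1 + 7 * L / (2 * lo)"
  have K: "K \<ge> 1" using L lo by (simp add: K_def)
  have K_lo: "2 * lo * K = 2 * lo + 7 * L" using lo by (simp add: K_def field_simps)
  have "compact (conformal_hessian v ` ?B)"
    unfolding conformal_hessian_eq
    by (intro compact_continuous_image continuous_on_conformal_jet cont comp) (use sub sub_ball in blast)
  moreover have "conformal_hessian v ` ?B \<subseteq> U" using sub sub_ball by blast
  ultimately obtain d where d: "d > 0"
    "\<And>A N. A \<in> conformal_hessian v ` ?B \<Longrightarrow> N \<in> sym_matrices \<Longrightarrow> norm N \<le> d \<Longrightarrow> A + N \<in> U"
    using compact_sym_neighbourhood[OF U] by metis
  define C where "C = 2 * K * hi * norm (mat 1 :: real^'n^'n) + 7 * L"
  have C: "C \<ge> 0" using K hi L by (simp add: C_def)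
  \<comment> \<open>The three bounds keep the perturbed value above \<open>m\<close>, its gradient below \<open>P\<close>, and the perturbed
    matrix in the \<open>d\<close>-neighbourhood of the compact set of values of \<open>A\<^sup>v\<close>.\<close>
  define \<epsilon>0 where "\<epsilon>0 = min (m / 4) (min (1 / 3) (d / (C + 1)))"
  have \<epsilon>0: "\<epsilon>0 > 0" using m d C by (simp add: \<epsilon>0_def)
  show thesis
  proof (rule that[OF K \<epsilon>0])
    fix \<epsilon> s :: real and x :: "real^'n"
    assume \<epsilon>: "0 < \<epsilon>" "\<epsilon> \<le> \<epsilon>0" and s: "0 \<le> s" "s \<le> 2" and xK: "norm x \<le> 1 / K"
    have \<epsilon>_le: "\<epsilon> \<le> m / 4" "\<epsilon> \<le> 1 / 3" "\<epsilon> \<le> d / (C + 1)" using \<epsilon> by (auto simp: \<epsilon>0_def)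
    have Kx: "K * norm x \<le> 1" using xK K by (simp add: field_simps)
    have x1: "norm x \<le> 1" using Kx mult_right_mono[OF K, of "norm x"] by simp
    then have xB: "x \<in> ?B" by simp
    define \<phi> where "\<phi> = K * (x \<bullet> x) + a \<bullet> x - s"
    define \<psi> where "\<psi> = (2 * K) *\<^sub>R x + a"
    have "K * (x \<bullet> x) = (K * norm x) * norm x" by (simp add: power2_norm_eq_inner[symmetric] power2_eq_square)
    also have "\<dots> \<le> 1 * 1" using Kx x1 by (intro mult_mono) auto
    finally have "K * (x \<bullet> x) \<le> 1" by simp
    moreover have "0 \<le> K * (x \<bullet> x)" using K by simp
    moreover have "\<bar>a \<bullet> x\<bar> \<le> 1" using Cauchy_Schwarz_ineq2[of a x] a x1 by simp
    ultimately have \<phi>: "\<bar>\<phi>\<bar> \<le> 4" using s by (auto simp: \<phi>_def)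
    have \<psi>: "norm \<psi> \<le> 3"
      unfolding \<psi>_def by (rule order_trans[OF norm_triangle_ineq]) (use a Kx K in simp)
    define z where "z = v x + \<epsilon> * \<phi>"
    define p where "p = gradient v x + \<epsilon> *\<^sub>R \<psi>"
    have "\<bar>\<epsilon> * \<phi>\<bar> \<le> \<epsilon> * 4" using \<epsilon> \<phi> by (simp add: abs_mult)
    then have z_near: "\<bar>v x - z\<bar> \<le> 4 * \<epsilon>" by (simp add: z_def)
    have p_near: "norm (gradient v x - p) \<le> 3 * \<epsilon>"
      using \<epsilon> mult_left_mono[OF \<psi>, of \<epsilon>] by (simp add: p_def)
    have vx: "2 * m \<le> v x" "v x \<le> v xM" using xm(2)[OF xB] xM(2)[OF xB] by (auto simp: m_def)
    have z: "m \<le> z" "z \<le> v xM + m" using vx z_near \<epsilon>_le by linarith+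
    have "norm p \<le> norm (gradient v x) + norm (gradient v x - p)"
      using norm_triangle_sub[of p "gradient v x"] by (simp add: norm_minus_commute)
    then have p: "norm p \<le> P" using P(2)[OF xB] p_near \<epsilon>_le by linarith
    define R where "R = conformal_jet (v x) (gradient v x) (hessian v x) - conformal_jet z p (hessian v x)"
    have "norm R \<le> L * (\<bar>v x - z\<bar> + norm (gradient v x - p))"
      unfolding R_def by (rule lip) (use vx m z p P(2,3)[OF xB] in auto)
    also have "\<dots> \<le> L * (4 * \<epsilon> + 3 * \<epsilon>)" using L z_near p_near by (intro mult_left_mono add_mono)
    finally have R: "norm R \<le> 7 * L * \<epsilon>" by (simp add: algebra_simps)
    define c where "c = hess_coeff TYPE('n) z * (2 * \<epsilon> * K)"
    have coeff: "lo \<le> hess_coeff TYPE('n) z" "hess_coeff TYPE('n) z \<le> hi"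
      unfolding lo_def hi_def using z m by (auto intro!: hess_coeff_antimono[OF n])
    define A where "A = conformal_jet z p (hessian v x + (2 * \<epsilon> * K) *\<^sub>R mat 1)"
    have v_conf: "conformal_hessian v x = A + (c *\<^sub>R mat 1 + R)"
      by (simp add: conformal_hessian_eq A_def R_def c_def conformal_jet_add_hess)
    have vU: "conformal_hessian v x \<in> U" using sub[OF sub_ball[OF xB]] by simp
    have v_sym: "conformal_hessian v x \<in> sym_matrices" using vU U openin_imp_subset by blast
    then have hess_sym: "hessian v x \<in> sym_matrices"
      unfolding conformal_hessian_eq using conformal_jet_sym_iff[OF n, of "v x"] vx m by simp
    have "z > 0" using z m by simp
    then have R_sym: "R \<in> sym_matrices"
      unfolding R_def using v_sym[unfolded conformal_hessian_eq] hess_sym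
      by (intro subspace_diff subspace_sym) (auto simp: conformal_jet_sym_iff[OF n])
    have "7 * L * \<epsilon> < (2 * lo * K) * \<epsilon>" unfolding K_lo using lo \<epsilon> by simp
    also have "\<dots> = lo * (2 * \<epsilon> * K)" by simp
    also have "\<dots> \<le> c" unfolding c_def using coeff \<epsilon> K by (intro mult_right_mono) auto
    finally have Rc: "norm R < c" using R by simp
    define N where "N = c *\<^sub>R mat 1 + R"
    have N: "pos_semidef N" "N \<noteq> 0"
      unfolding N_def using pos_semidef_perturbed_identity[OF R_sym Rc] by auto
    have c0: "c \<ge> 0" using Rc norm_ge_zero[of R] by linarith
    have "norm N \<le> c * norm (mat 1 :: real^'n^'n) + norm R"
      unfolding N_def by (rule order_trans[OF norm_triangle_ineq]) (use c0 in simp)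
    also have "\<dots> \<le> (hi * (2 * \<epsilon> * K)) * norm (mat 1 :: real^'n^'n) + 7 * L * \<epsilon>"
      unfolding c_def using coeff \<epsilon> K R by (intro add_mono mult_right_mono) auto
    also have "\<dots> = C * \<epsilon>" by (simp add: C_def algebra_simps)
    also have "\<dots> \<le> (C + 1) * \<epsilon>" using \<epsilon> by simp
    also have "\<dots> \<le> d" using \<epsilon>_le(3) C by (simp add: field_simps)
    finally have Nd: "norm N \<le> d" .
    have N_sym: "N \<in> sym_matrices" using N by (simp add: pos_semidef_def)
    have seg: "A + t *\<^sub>R N \<in> U" if t: "0 \<le> t" "t \<le> 1" for t
    proof -
      have "norm ((t - 1) *\<^sub>R N) \<le> 1 * norm N" using t by (simp add: mult_left_le_one_le)
      moreover have "(t - 1) *\<^sub>R N \<in> sym_matrices" using N_sym by (intro subspace_scale subspace_sym)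
      ultimately have "conformal_hessian v x + (t - 1) *\<^sub>R N \<in> U" using d(2) xB Nd by auto
      then show ?thesis by (simp add: v_conf N_def algebra_simps)
    qed
    have "F A < F (A + N)" using strictly_increasing_along_segment[OF U F pd N seg] .
    also have "\<dots> \<le> 1" using sub[OF sub_ball[OF xB]] by (simp add: v_conf N_def)
    finally have "F A < 1" .
    moreover have "A \<in> U" using seg[of 0] by simp
    ultimately show "conformal_jet (v x + \<epsilon> * (K * (x \<bullet> x) + a \<bullet> x - s))
        (gradient v x + \<epsilon> *\<^sub>R ((2 * K) *\<^sub>R x + a)) (hessian v x + (2 * \<epsilon> * K) *\<^sub>R mat 1) \<in> {A \<in> U. F A < 1}"
      by (simp add: A_def z_def p_def \<phi>_def \<psi>_def)
  qed
qed

section \<open>The comparison theorem\<close>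

theorem theorem1p6:
  fixes U :: "(real^'n^'n) set"
    and F :: "real^'n^'n \<Rightarrow> real"
    and u v :: "real^'n \<Rightarrow> real"
  assumes "CARD('n) \<ge> 3"
    and "openin (top_of_set sym_matrices) U"
    and "\<And>Q. orthogonal_matrix Q \<Longrightarrow> (\<lambda>M. matrix_inv Q ** M ** Q) ` U = U"
    and "\<And>M N. M \<in> sym_matrices \<Longrightarrow> pos_def N \<Longrightarrow>
           convex (U \<inter> {M + t *\<^sub>R N | t. 0 < t})"
    and "matrix_C1_on U F"
    and "\<And>M Q. M \<in> U \<Longrightarrow> orthogonal_matrix Q \<Longrightarrow> F (matrix_inv Q ** M ** Q) = F M"
    and "\<And>M. M \<in> U \<Longrightarrow> pos_def (matrix_gradient U F M)"
    and "C2_on (ball 0 2 - {0}) u"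
    and "C2_on (ball 0 2) v"
    and "\<And>x. x \<in> ball 0 2 - {0} \<Longrightarrow> u x > v x"
    and "\<And>x. x \<in> ball 0 2 - {0} \<Longrightarrow>
           F (conformal_hessian u x) \<ge> 1 \<and> conformal_hessian u x \<in> U \<and> laplacian u x \<le> 0"
    and "\<And>x. x \<in> ball 0 2 \<Longrightarrow>
           F (conformal_hessian v x) \<le> 1 \<and> conformal_hessian v x \<in> U \<and> v x > 0"
  shows "Liminf (at 0) (\<lambda>x. ereal (u x - v x)) > 0"
proof -
  note n = assms(1) and U = assms(2) and conv = assms(4) and pd = assms(7)
    and above = assms(10) and super = assms(11) and sub = assms(12)
  have F: "F differentiable_on U" using assms(5) by (simp add: matrix_C1_on_def)
  have open_punctured: "open (ball 0 2 - {0 :: real^'n})" by (intro open_delete open_ball)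
  note du = C2_on_derivatives[OF assms(8) open_punctured]
  note dv = C2_on_derivatives[OF assms(9) open_ball]
  define a :: "real^'n" where "a = axis undefined 1"
  have a: "norm a = 1" by (simp add: a_def)
  obtain K \<epsilon>0 where K: "K \<ge> 1" and \<epsilon>0: "\<epsilon>0 > 0" and strict:
    "\<And>\<epsilon> s x. 0 < \<epsilon> \<Longrightarrow> \<epsilon> \<le> \<epsilon>0 \<Longrightarrow> 0 \<le> s \<Longrightarrow> s \<le> 2 \<Longrightarrow> norm x \<le> 1 / K \<Longrightarrow>
      conformal_jet (v x + \<epsilon> * (K * (x \<bullet> x) + a \<bullet> x - s)) (gradient v x + \<epsilon> *\<^sub>R ((2 * K) *\<^sub>R x + a))
        (hessian v x + (2 * \<epsilon> * K) *\<^sub>R mat 1) \<in> {A \<in> U. F A < 1}"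
    using strict_subsolution_perturbation[OF n U F pd assms(9) sub a] by blast
  define r where "r = 1 / K"
  have r: "0 < r" "r \<le> 1" using K by (auto simp: r_def)
  define \<theta> where "\<theta> x = K * (x \<bullet> x) + a \<bullet> x" for x
  have \<theta>_le: "\<theta> x \<le> 2" if "norm x \<le> r" for x
  proof -
    have Kx: "K * norm x \<le> 1" using that K by (simp add: r_def field_simps)
    have x1: "norm x \<le> 1" using that r by simp
    have "K * (x \<bullet> x) = (K * norm x) * norm x"
      by (simp add: power2_norm_eq_inner[symmetric] power2_eq_square)
    also have "\<dots> \<le> 1 * 1" using Kx x1 by (intro mult_mono) auto
    finally have "K * (x \<bullet> x) \<le> 1" by simp
    moreover have "a \<bullet> x \<le> 1" using norm_cauchy_schwarz[of a x] a that r by simp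
    ultimately show ?thesis by (simp add: \<theta>_def)
  qed
  have d\<theta>: "(\<theta> has_derivative (\<lambda>h. ((2 * K) *\<^sub>R x + a) \<bullet> h)) (at x)" for x
    unfolding \<theta>_def by (auto intro!: derivative_eq_intros
        simp: fun_eq_iff inner_add_left inner_commute algebra_simps)
  have cont_uv: "continuous_on (ball 0 2 - {0}) (\<lambda>x. u x - v x)"
    by (intro continuous_at_imp_continuous_on ballI continuous_diff
        has_derivative_continuous[OF du(1)] has_derivative_continuous[OF dv(1)]) auto
  obtain \<delta> where \<delta>: "\<delta> > 0" "\<And>x. norm x = r \<Longrightarrow> \<delta> \<le> u x - v x"
  proof -
    have "sphere 0 r \<subseteq> ball 0 2 - {0 :: real^'n}" using r by auto
    moreover have "sphere (0 :: real^'n) r \<noteq> {}" using r by simp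
    ultimately obtain y where y: "y \<in> sphere 0 r" "\<And>x. x \<in> sphere 0 r \<Longrightarrow> u y - v y \<le> u x - v x"
      using continuous_attains_inf[OF compact_sphere, of 0 r "\<lambda>x. u x - v x"]
        continuous_on_subset[OF cont_uv] by blast
    have "y \<in> ball 0 2 - {0}" using y(1) r by auto
    then show thesis using that[of "u y - v y"] above[of y] y(2) by simp
  qed
  define \<epsilon> where "\<epsilon> = min \<epsilon>0 (\<delta> / 2)"
  have \<epsilon>: "0 < \<epsilon>" "\<epsilon> \<le> \<epsilon>0" "\<epsilon> \<le> \<delta> / 2" using \<epsilon>0 \<delta> by (auto simp: \<epsilon>_def)
  have in_ball: "x \<in> ball 0 2 - {0}" if "x \<in> ball 0 r - {0}" for x :: "real^'n"
    using that r by auto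
  \<comment> \<open>If the tilted function exceeded \<open>u\<close>, then \<open>m\<close>, its distance below \<open>u\<close>, would have a negative
    minimum \<open>- \<epsilon> * s\<close> off the origin. Lowered by \<open>\<epsilon> * s\<close>, the tilted function is a strict subsolution
    that touches the supersolution \<open>u\<close> from below at this point.\<close>
  have tilted: "v x + \<epsilon> * \<theta> x \<le> u x" if x: "x \<in> ball 0 r - {0}" for x
  proof (rule ccontr)
    define m where "m x = u x - v x - \<epsilon> * \<theta> x" for x
    define g where "g x = gradient u x - gradient v x - \<epsilon> *\<^sub>R ((2 * K) *\<^sub>R x + a)" for x
    define H where "H x h = hessian u x *v h - hessian v x *v h - \<epsilon> *\<^sub>R ((2 * K) *\<^sub>R h)" for x h
    have dm: "(m has_derivative (\<lambda>h. g x \<bullet> h)) (at x)" if "x \<in> ball 0 2 - {0}" for x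
      unfolding m_def g_def using that
      by (auto intro!: derivative_eq_intros du(1) dv(1) d\<theta> simp: inner_diff_left)
    have dg: "(g has_derivative H x) (at x)" if "x \<in> ball 0 2 - {0}" for x
      unfolding H_def g_def using that
      by (auto intro!: derivative_eq_intros du(2) dv(2))
    assume "\<not> v x + \<epsilon> * \<theta> x \<le> u x"
    then have neg: "m x < 0" by (simp add: m_def)
    obtain x0 where x0: "x0 \<in> ball 0 r - {0}" "m x0 < 0"
      "\<And>x. x \<in> ball 0 r - {0} \<Longrightarrow> m x0 \<le> m x"
    proof (rule interior_negative_minimum[of r m, OF _ _ _ x neg])
      show "continuous_on (cball 0 r - {0}) m"
        using r by (intro continuous_at_imp_continuous_on ballI has_derivative_continuous[OF dm]) auto
      show "m x \<ge> 0" if "norm x = r" for x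
      proof -
        have "\<epsilon> * \<theta> x \<le> \<delta> / 2 * 2" using \<epsilon> \<theta>_le[of x] that
          by (intro order_trans[OF mult_left_mono mult_right_mono]) auto
        then show ?thesis using \<delta>(2)[OF that] by (simp add: m_def)
      qed
      show "\<forall>\<^sub>F x in at 0. m x > c" if "c < 0" for c
      proof -
        have "((\<lambda>x. - (\<epsilon> * \<theta> x)) \<longlongrightarrow> - (\<epsilon> * \<theta> 0)) (at 0)"
          unfolding \<theta>_def by (intro tendsto_intros)
        then have "\<forall>\<^sub>F x in at 0. - (\<epsilon> * \<theta> x) > c"
          by (rule order_tendstoD) (use that in \<open>simp add: \<theta>_def\<close>)
        moreover have "\<forall>\<^sub>F x :: real^'n in at 0. x \<in> ball 0 r - {0}"
          using r by (auto simp: eventually_at)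
        ultimately show ?thesis
        proof eventually_elim
          fix x :: "real^'n" assume "- (\<epsilon> * \<theta> x) > c" "x \<in> ball 0 r - {0}"
          then show "m x > c" using above[OF in_ball, of x] by (simp add: m_def)
        qed
      qed
    qed auto
    have x0_2: "x0 \<in> ball 0 2 - {0}" by (rule in_ball[OF x0(1)])
    have "open (ball 0 r - {0 :: real^'n})" by (intro open_delete open_ball)
    note test = second_derivative_test[OF this x0(1) dm[OF in_ball] dg[OF x0_2] x0(3)]
    have crit: "g x0 = 0" and psd: "\<And>y. y \<bullet> H x0 y \<ge> 0"
      using test by blast+
    define s where "s = - m x0 / \<epsilon>"
    have s_pos: "s > 0" using x0(2) \<epsilon> by (simp add: s_def divide_neg_pos)
    have u_eq: "u x0 = v x0 + \<epsilon> * (\<theta> x0 - s)" using \<epsilon> by (simp add: s_def m_def field_simps)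
    \<comment> \<open>The strict inequality \<open>u > v\<close> at the contact point bounds the height \<open>s\<close> of the slide.\<close>
    have "\<epsilon> * (\<theta> x0 - s) > 0" using u_eq above[OF x0_2] by simp
    then have "s < \<theta> x0" using \<epsilon> by (simp add: zero_less_mult_iff)
    then have s_le: "s \<le> 2" using \<theta>_le[of x0] x0(1) by auto
    have grad_eq: "gradient u x0 = gradient v x0 + \<epsilon> *\<^sub>R ((2 * K) *\<^sub>R x0 + a)"
      using crit by (simp add: g_def algebra_simps)
    define A where "A = conformal_jet (u x0) (gradient u x0) (hessian v x0 + (2 * \<epsilon> * K) *\<^sub>R mat 1)"
    have A: "A \<in> U" "F A < 1"
      using strict[of \<epsilon> s x0] \<epsilon> s_pos s_le x0(1)
      by (auto simp: A_def grad_eq u_eq \<theta>_def r_def)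
    define Au where "Au = conformal_hessian u x0"
    have Au: "Au \<in> U" "F Au \<ge> 1" using super[OF x0_2] by (auto simp: Au_def)
    define D where "D = hessian u x0 - hessian v x0 - (2 * \<epsilon> * K) *\<^sub>R mat 1"
    have "A = conformal_jet (u x0) (gradient u x0) (hessian u x0 + (- D))"
      by (simp add: A_def D_def add.commute)
    then have A_diff: "A - Au = hess_coeff TYPE('n) (u x0) *\<^sub>R D"
      unfolding conformal_jet_add_hess by (simp add: Au_def conformal_hessian_eq)
    have "u x0 > 0" using above[OF x0_2] sub[of x0] x0_2 by force
    then have coeff: "hess_coeff TYPE('n) (u x0) > 0" by (rule hess_coeff_pos[OF n])
    have "D *v y = H x0 y" for y
      by (simp add: D_def H_def matrix_vector_mult_diff_rdistrib scaleR_matrix_vector_assoc[symmetric]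
          mult_ac)
    then have "y \<bullet> ((A - Au) *v y) \<ge> 0" for y
      unfolding A_diff using psd[of y] coeff by (simp add: scaleR_matrix_vector_assoc[symmetric])
    moreover have "A - Au \<in> sym_matrices"
      using A(1) Au(1) openin_imp_subset[OF U] by (intro subspace_diff subspace_sym) auto
    ultimately have "pos_semidef (A - Au)" by (simp add: pos_semidef_def)
    then have "F Au \<le> F A" using nondecreasing_in_matrix_order[OF U conv F pd Au(1) A(1)] by blast
    then show False using A(2) Au(2) by simp
  qed
  have dv0: "(v has_derivative (\<lambda>h. gradient v 0 \<bullet> h)) (at 0)" by (rule dv(1)) simp
  have dw0: "((\<lambda>x. v x + \<epsilon> * \<theta> x) has_derivative (\<lambda>h. (gradient v 0 + \<epsilon> *\<^sub>R a) \<bullet> h)) (at 0)"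
    using d\<theta>[of 0] by (auto intro!: derivative_eq_intros dv0 simp: inner_add_left)
  obtain c where c: "c > v 0" "\<forall>\<^sub>F x in at 0. u x \<ge> c"
  proof (rule superharmonic_above_kink[OF n r(1), where u=u and gu="gradient u" and Hu="hessian u"
        and ?w1.0=v and ?w2.0="\<lambda>x. v x + \<epsilon> * \<theta> x" and ?b1.0="gradient v 0" and ?b2.0="gradient v 0 + \<epsilon> *\<^sub>R a"])
    show "trace (hessian u x) \<le> 0" if "x \<in> ball 0 r - {0}" for x
      using super[OF in_ball[OF that]] by (simp add: laplacian_def)
    show "v x \<le> u x" if "x \<in> ball 0 r - {0}" for x
      using above[OF in_ball[OF that]] by simp
    show "gradient v 0 \<noteq> gradient v 0 + \<epsilon> *\<^sub>R a" using \<epsilon> a by auto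
  qed (use du in_ball dv0 dw0 tilted in \<open>auto simp: \<theta>_def\<close>)
  define g where "g = (c - v 0) / 2"
  have g: "g > 0" using c(1) by (simp add: g_def)
  have "(v \<longlongrightarrow> v 0) (at 0)"
    using has_derivative_continuous[OF dv0] by (simp add: continuous_at)
  then have "\<forall>\<^sub>F x in at 0. v x < v 0 + g" by (rule order_tendstoD) (use g in simp)
  with c(2) have "\<forall>\<^sub>F x in at 0. ereal g \<le> ereal (u x - v x)"
    by eventually_elim (simp add: g_def field_simps)
  then have "ereal g \<le> Liminf (at 0) (\<lambda>x. ereal (u x - v x))" by (rule Liminf_bounded)
  moreover have "(0 :: ereal) < ereal g" using g by simp
  ultimately show ?thesis by (rule less_le_trans[rotated])
qed

end
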